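(* Let $\mathcal{A}$ be a complex unital semisimple Banach algebra with $\mathrm{soc}(\mathcal{A})\neq\{0\}$, and let $f\in\mathcal{A}$. The following statements are equivalent: (i) $f^n\in\mathrm{soc}(\mathcal{A})$ for some $n\in\mathbb{N}$; (ii) $f$ is a Riesz and Drazin invertible element; (iii) $f$ is a Riesz and B-Weyl element; (iv) $f$ is a Riesz and B-Fredholm element.
   Context: Semisimple means the Jacobson radical is $\{0\}$. $\mathrm{soc}(\mathcal{A})$ is the sum of all minimal right ideals of $\mathcal{A}$ (equal to the sum of all minimal left ideals), or $\{0\}$ if there are none. An element $a\in\mathcal{A}$ is a Riesz element if its image in the Banach algebra $\mathcal{A}/\overline{\mathrm{soc}(\mathcal{A})}$ is quasinilpotent. An element $a$ of a ring is Drazin invertible if there are $b$ in the ring (the Drazin inverse, which is unique) and $k\in\mathbb{N}$ with $bab=b$, $ab=ba$, $a^kba=a^k$. Let $\pi:\mathcal{A}\to\mathcal{A}/\mathrm{soc}(\mathcal{A})$ be the canonical homomorphism; $a\in\mathcal{A}$ is B-Fredholm if $\pi(a)$ is Drazin invertible. For $a\in\mathrm{soc}(\mathcal{A})$ the trace is $\tau(a)=\sum_{\lambda\in\sigma(a)}\lambda\,m(\lambda,a)$, where $m(\lambda,a)$ is the algebraic multiplicity of $\lambda$ for $a$ in the sense of Aupetit and Mouton; for nonzero $\lambda\in\sigma(a)$ (there are finitely many) it is the rank of the Riesz (spectral) idempotent $p$ of $a$ at $\lambda$, which lies in $\mathrm{soc}(\mathcal{A})$, i.e. the smallest number of minimal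 right ideals of $\mathcal{A}$ whose sum is $p\mathcal{A}$. The index of a B-Fredholm element $a$ is $\mathrm{i}(a)=\tau(aa_0-a_0a)$, where $a_0\in\mathcal{A}$ is any element such that $\pi(a_0)$ is the Drazin inverse of $\pi(a)$ (independent of the choice of $a_0$). An element is B-Weyl if it is B-Fredholm of index zero. *)

theory Defs
  imports
    "HOL-Analysis.Analysis"
    "HOL-Complex_Analysis.Contour_Integration"
    "HOL-Algebra.QuotRing"
    "HOL-Algebra.Algebraic_Closure_Type"
begin

section \<open>Complex unital Banach algebras\<close>

text \<open>
  The normalisation \<open>norm 1 = 1\<close> is not assumed. The real scalar multiplication and the ring
  structure come from the real classes; \<open>scaleC\<close> extends the former.
\<close>

class complex_banach_algebra = real_algebra_1 + real_normed_algebra + banach +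
  fixes scaleC :: "complex \<Rightarrow> 'a \<Rightarrow> 'a"  (infixr \<open>*\<^sub>C\<close> 75)
  assumes scaleC_add_right: "c *\<^sub>C (x + y) = c *\<^sub>C x + c *\<^sub>C y"
    and scaleC_add_left: "(c + d) *\<^sub>C x = c *\<^sub>C x + d *\<^sub>C x"
    and scaleC_scaleC: "c *\<^sub>C d *\<^sub>C x = (c * d) *\<^sub>C x"
    and scaleC_one: "1 *\<^sub>C x = x"
    and scaleC_of_real: "complex_of_real r *\<^sub>C x = r *\<^sub>R x"
    and mult_scaleC_left: "(c *\<^sub>C x) * y = c *\<^sub>C (x * y)"
    and mult_scaleC_right: "x * (c *\<^sub>C y) = c *\<^sub>C (x * y)"
    and norm_scaleC: "norm (c *\<^sub>C x) = cmod c * norm x"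

text \<open>The algebra as a ring of HOL-Algebra, where the quotient rings are formed.\<close>

abbreviation alg :: "'a::complex_banach_algebra ring" where
  "alg \<equiv> ring_of_type_algebra"

abbreviation quot_map :: "'a::complex_banach_algebra set \<Rightarrow> 'a \<Rightarrow> 'a set" where
  "quot_map J a \<equiv> J +>\<^bsub>alg\<^esub> a"


section \<open>One-sided ideals, Jacobson radical and socle\<close>

text \<open>Closure under negation and scalars follows, since the algebra is unital.\<close>

definition right_ideal :: "'a::complex_banach_algebra set \<Rightarrow> bool" where
  "right_ideal I \<longleftrightarrow> 0 \<in> I \<and> (\<forall>x\<in>I. \<forall>y\<in>I. x + y \<in> I) \<and> (\<forall>x\<in>I. \<forall>a. x * a \<in> I)"

definition left_ideal :: "'a::complex_banach_algebra set \<Rightarrow> bool" where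
  "left_ideal I \<longleftrightarrow> 0 \<in> I \<and> (\<forall>x\<in>I. \<forall>y\<in>I. x + y \<in> I) \<and> (\<forall>x\<in>I. \<forall>a. a * x \<in> I)"

definition maximal_left_ideal :: "'a::complex_banach_algebra set \<Rightarrow> bool" where
  "maximal_left_ideal M \<longleftrightarrow> left_ideal M \<and> M \<noteq> UNIV \<and>
     (\<forall>L. left_ideal L \<and> M \<subseteq> L \<longrightarrow> L = M \<or> L = UNIV)"

definition jacobson_radical :: "'a::complex_banach_algebra set" where
  "jacobson_radical = \<Inter> {M. maximal_left_ideal M}"

definition minimal_right_ideal :: "'a::complex_banach_algebra set \<Rightarrow> bool" where
  "minimal_right_ideal R \<longleftrightarrow> right_ideal R \<and> R \<noteq> {0} \<and>
     (\<forall>S. right_ideal S \<and> S \<subseteq> R \<longrightarrow> S = {0} \<or> S = R)"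

text \<open>The algebraic sum of a family of ideals; it is \<open>{0}\<close> for the empty family.\<close>

definition ideal_sum :: "'a::complex_banach_algebra set set \<Rightarrow> 'a set" where
  "ideal_sum \<R> = {(\<Sum>R\<in>F. x R) | F x. finite F \<and> F \<subseteq> \<R> \<and> (\<forall>R\<in>F. x R \<in> R)}"

definition soc :: "'a::complex_banach_algebra set" where
  "soc = ideal_sum {R. minimal_right_ideal R}"


section \<open>Spectrum, Riesz elements, Drazin invertibility\<close>

text \<open>
  Here \<open>h z\<close> is the scalar \<open>z\<close> times the unit of the algebra with underlying ring \<open>R\<close>.
\<close>

definition ring_spectrum :: "('r, 'm) ring_scheme \<Rightarrow> (complex \<Rightarrow> 'r) \<Rightarrow> 'r \<Rightarrow> complex set" where
  "ring_spectrum R h x = {z. h z \<ominus>\<^bsub>R\<^esub> x \<notin> Units R}"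

text \<open>
  The inclusion, rather than equality, covers the zero algebra, in which the spectrum of \<open>0\<close> is
  empty. This case does occur: the closure of the socle may be the whole algebra.
\<close>

definition quasinilpotent :: "('r, 'm) ring_scheme \<Rightarrow> (complex \<Rightarrow> 'r) \<Rightarrow> 'r \<Rightarrow> bool" where
  "quasinilpotent R h x \<longleftrightarrow> ring_spectrum R h x \<subseteq> {0}"

definition spectrum :: "'a::complex_banach_algebra \<Rightarrow> complex set" where
  "spectrum a = ring_spectrum alg (\<lambda>z. z *\<^sub>C 1) a"

definition riesz_element :: "'a::complex_banach_algebra \<Rightarrow> bool" where
  "riesz_element a \<longleftrightarrow>
     quasinilpotent (alg Quot closure soc) (\<lambda>z. quot_map (closure soc) (z *\<^sub>C 1))
       (quot_map (closure soc) a)"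

definition is_drazin_inverse :: "('r, 'm) ring_scheme \<Rightarrow> 'r \<Rightarrow> 'r \<Rightarrow> bool" where
  "is_drazin_inverse R a b \<longleftrightarrow> b \<in> carrier R \<and>
     b \<otimes>\<^bsub>R\<^esub> a \<otimes>\<^bsub>R\<^esub> b = b \<and> a \<otimes>\<^bsub>R\<^esub> b = b \<otimes>\<^bsub>R\<^esub> a \<and>
     (\<exists>k::nat. a [^]\<^bsub>R\<^esub> k \<otimes>\<^bsub>R\<^esub> b \<otimes>\<^bsub>R\<^esub> a = a [^]\<^bsub>R\<^esub> k)"

definition drazin_invertible :: "('r, 'm) ring_scheme \<Rightarrow> 'r \<Rightarrow> bool" where
  "drazin_invertible R a \<longleftrightarrow> (\<exists>b. is_drazin_inverse R a b)"

definition b_fredholm :: "'a::complex_banach_algebra \<Rightarrow> bool" where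
  "b_fredholm a \<longleftrightarrow> drazin_invertible (alg Quot soc) (quot_map soc a)"


section \<open>Riesz idempotents, trace and index\<close>

text \<open>The integral along \<open>\<gamma>\<close> of an algebra-valued function.\<close>

definition alg_contour_integral ::
    "(real \<Rightarrow> complex) \<Rightarrow> (complex \<Rightarrow> 'a::complex_banach_algebra) \<Rightarrow> 'a" where
  "alg_contour_integral \<gamma> g =
     integral {0..1} (\<lambda>t. vector_derivative \<gamma> (at t within {0..1}) *\<^sub>C g (\<gamma> t))"

text \<open>
  For an isolated point \<open>\<mu>\<close> of the spectrum, the integral of the resolvent has the same value on
  all sufficiently small circles around \<open>\<mu>\<close>; that value is the Riesz idempotent.
\<close>

definition riesz_idempotent :: "complex \<Rightarrow> 'a::complex_banach_algebra \<Rightarrow> 'a" where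
  "riesz_idempotent \<mu> a = (THE p. \<forall>\<^sub>F r in at_right 0.
     p = (1 / (2 * pi * \<i>)) *\<^sub>C
       alg_contour_integral (circlepath \<mu> r) (\<lambda>z. inv\<^bsub>alg\<^esub> (z *\<^sub>C 1 - a)))"

text \<open>The rank is meant for elements of the socle, where such a finite family exists.\<close>

definition alg_rank :: "'a::complex_banach_algebra \<Rightarrow> nat" where
  "alg_rank p = (LEAST n. \<exists>\<R>. finite \<R> \<and> card \<R> = n \<and> (\<forall>R\<in>\<R>. minimal_right_ideal R) \<and>
     ideal_sum \<R> = range (\<lambda>x. p * x))"

text \<open>
  Used only for nonzero spectral values of elements of the socle; the value at \<open>0\<close> is
  irrelevant, as it is multiplied by \<open>0\<close> in the trace.
\<close>

definition alg_mult :: "complex \<Rightarrow> 'a::complex_banach_algebra \<Rightarrow> nat" where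
  "alg_mult \<mu> a = alg_rank (riesz_idempotent \<mu> a)"

definition alg_trace :: "'a::complex_banach_algebra \<Rightarrow> complex" where
  "alg_trace a = (\<Sum>\<mu>\<in>spectrum a. \<mu> * of_nat (alg_mult \<mu> a))"

text \<open>In a semisimple algebra the value does not depend on which \<open>a\<^sub>0\<close> is chosen.\<close>

definition b_index :: "'a::complex_banach_algebra \<Rightarrow> complex" where
  "b_index a =
     (let a\<^sub>0 = (SOME a\<^sub>0. is_drazin_inverse (alg Quot soc) (quot_map soc a) (quot_map soc a\<^sub>0))
      in alg_trace (a * a\<^sub>0 - a\<^sub>0 * a))"

definition b_weyl :: "'a::complex_banach_algebra \<Rightarrow> bool" where
  "b_weyl a \<longleftrightarrow> b_fredholm a \<and> b_index a = 0"

end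

theory Submission
  imports Defs "HOL-Complex_Analysis.Cauchy_Integral_Formula"
begin

text \<open>
  If \<open>f\<close> is Riesz and B-Fredholm with inverse \<open>b\<close> modulo the socle, then modulo the closed socle
  \<open>p = f b\<close> is an idempotent in whose corner \<open>f\<close> is invertible and quasinilpotent, so \<open>p\<close> lies in
  the closure of the socle because spectra are nonempty; an element that is idempotent modulo an
  ideal and lies in its closure already lies in the ideal, so \<open>f\<^sup>k\<close>, which is \<open>f\<^sup>k p\<close> modulo the
  socle, lies in the socle.

  Conversely let \<open>f\<^sup>n\<close> be in the socle. Finitely many elements of the socle have a common two-sided
  unit \<open>g\<close> that is a sum of orthogonal minimal idempotents \<open>e\<close>. Reading off the scalars in
  \<open>e x e \<in> \<complex> e\<close> and adding them up gives a linear functional that vanishes on commutators and on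
  nilpotents and maps an idempotent to its rank. Comparing ranks shows that the powers of \<open>f\<close>
  stabilise, hence \<open>f\<close> is Drazin invertible; and by spectral decomposition the functional is the
  trace \<open>\<tau>\<close>, so that \<open>\<tau>(f a\<^sub>0 - a\<^sub>0 f) = 0\<close> for every \<open>a\<^sub>0\<close> in the socle.
\<close>

section \<open>Liouville's theorem for pseudo-resolvents\<close>


text \<open>Nonempty spectra are needed in three places: in \<open>e A e\<close> for a generator
  \<open>e\<close> of a minimal right ideal, in corners of the socle, and in a corner modulo the
  closed socle. One argument covers all of them because it is carried out for a submultiplicative
  seminorm on the algebra itself, with equations required only up to seminorm 0; the quotient norm
  then appears as the distance to the ideal. The second obstacle is that \<tau> is defined through
  contour integrals and ranks and is not visibly additive, while the functional attached to a frame
  is linear by construction but tied to that frame. Independence of the frame is not established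
  beforehand: each argument fixes one frame that absorbs all elements in play and computes there.
  Additivity of ranks is drawn from linearity in the same way, by reading the rank of an idempotent
  as its trace.\<close>

interpretation cvec: vector_space "scaleC :: complex \<Rightarrow> 'a::complex_banach_algebra \<Rightarrow> 'a"
  by unfold_locales (simp_all add: scaleC_add_right scaleC_add_left scaleC_scaleC scaleC_one)

lemmas scaleC_simps = mult_scaleC_left mult_scaleC_right

text \<open>\<open>N\<close> may vanish on nonzero elements, so that the distance to a two-sided
  ideal is an instance beside the norm. Equality modulo the kernel takes the form
  \<open>N (x - y) = 0\<close>; the rules on null elements say that this kernel is a two-sided
  ideal.\<close>

locale algebra_seminorm =
  fixes N :: "'a::complex_banach_algebra \<Rightarrow> real"
  assumes add_le: "N (x + y) \<le> N x + N y"
    and mult_le: "N (x * y) \<le> N x * N y"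
    and scale: "N (c *\<^sub>C x) = cmod c * N x"
begin

lemma zero [simp]: "N 0 = 0"
  using scale[of 0 0] by simp

lemma minus [simp]: "N (- x) = N x"
  using scale[of "-1" x] by simp

lemma nonneg [simp]: "0 \<le> N x"
  using add_le[of x "- x"] by simp

lemma diff_le: "N (x - y) \<le> N x + N y"
  using add_le[of x "- y"] by simp

lemma abs_diff_le: "\<bar>N x - N y\<bar> \<le> N (x - y)"
  using add_le[of "x - y" y] diff_le[of x "x - y"] by (simp add: algebra_simps)

lemma null_cong: "N (x - y) = 0 \<Longrightarrow> N x = N y"
  using abs_diff_le[of x y] by simp

lemma null_add: "N x = 0 \<Longrightarrow> N y = 0 \<Longrightarrow> N (x + y) = 0"
  using add_le[of x y] nonneg[of "x + y"] by simp

lemma null_diff: "N x = 0 \<Longrightarrow> N y = 0 \<Longrightarrow> N (x - y) = 0"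
  using null_add[of x "- y"] by simp

lemma null_mult: "N x = 0 \<or> N y = 0 \<Longrightarrow> N (x * y) = 0"
  using mult_le[of x y] nonneg[of "x * y"] by (metis antisym mult_eq_0_iff)

lemma null_scale: "N x = 0 \<Longrightarrow> N (c *\<^sub>C x) = 0"
  by (simp add: scale)

lemma null_sum: "(\<And>i. i \<in> I \<Longrightarrow> N (f i) = 0) \<Longrightarrow> N (sum f I) = 0"
  by (induction I rule: infinite_finite_induct) (auto intro: null_add)

lemma sum_le: "N (sum f I) \<le> (\<Sum>i\<in>I. N (f i))"
  by (induction I rule: infinite_finite_induct) (auto intro: order_trans[OF add_le])

lemma mult_power_le: "N (x * y ^ n) \<le> N x * N y ^ n"
proof (induction n)
  case (Suc n)
  have "N (x * y ^ Suc n) \<le> N (x * y ^ n) * N y"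
    using mult_le[of "x * y ^ n" y] by (simp add: mult.assoc power_commutes)
  also have "\<dots> \<le> N x * N y ^ n * N y"
    using Suc by (intro mult_right_mono) auto
  finally show ?case by (simp add: mult_ac)
qed simp

text \<open>The resolvent identity
  \<open>y (\<nu> + g) = y \<nu> - g (y (\<nu> + g) * y \<nu>)\<close>, substituted into itself
  \<open>n\<close> times. Keeping the exact remainder leaves no convergence to discuss.\<close>

lemma pseudo_resolvent_expansion:
  assumes res: "\<And>\<nu> \<mu>. N (y \<nu> - y \<mu> - (\<mu> - \<nu>) *\<^sub>C (y \<nu> * y \<mu>)) = 0"
  shows "N (y (\<nu> + g) - ((\<Sum>j<n. (- g) ^ j *\<^sub>C y \<nu> ^ Suc j)
    + (- g) ^ n *\<^sub>C (y (\<nu> + g) * y \<nu> ^ n))) = 0"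
proof (induction n)
  case (Suc n)
  let ?u = "y (\<nu> + g)" and ?v = "y \<nu>"
  have "N (?u - ?v - (- g) *\<^sub>C (?u * ?v)) = 0"
    using res[of "\<nu> + g" \<nu>] by simp
  hence "N ((- g) ^ n *\<^sub>C ((?u - ?v - (- g) *\<^sub>C (?u * ?v)) * ?v ^ n)) = 0"
    by (intro null_scale null_mult) simp
  from null_add[OF Suc.IH this]
  show ?case
    by (simp add: algebra_simps scaleC_simps power_commutes cvec.scale_right_diff_distrib)
qed simp

section \<open>Mean values over roots of unity\<close>

lemma sum_cis_roots_unity:
  fixes n j :: nat
  assumes "j < n"
  shows "(\<Sum>k<n. (cis (2 * pi / n) ^ k) ^ j) = (if j = 0 then of_nat n else 0)"
proof (cases "j = 0")
  case False
  define w where "w = cis (2 * pi / n) ^ j"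
  have w: "w = cis (2 * pi * j / n)"
    unfolding w_def Complex.DeMoivre by (simp add: mult_ac)
  have "w \<noteq> 1"
  proof
    assume "w = 1"
    hence "cos (2 * pi * j / n) = 1"
      by (simp add: w complex_eq_iff)
    then obtain i :: int where "2 * pi * j / n = i * 2 * pi"
      using cos_one_2pi_int by auto
    hence "real j = i * n"
      using assms by (simp add: field_simps)
    hence *: "int j = i * int n"
      by (metis of_int_eq_iff of_int_mult of_int_of_nat_eq)
    have "0 < i * int n" "i * int n < 1 * int n"
      using * assms False by linarith+
    hence "0 < i" "i < 1"
      using assms by (simp_all add: zero_less_mult_iff mult_less_cancel_right del: mult_1)
    thus False by simp
  qed
  moreover have "w ^ n = 1"
    using assms by (simp add: w Complex.DeMoivre)
  ultimately have "(\<Sum>k<n. w ^ k) = 0"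
    by (simp add: geometric_sum)
  thus ?thesis
    using False by (simp add: w_def mult.commute flip: power_mult)
qed simp

text \<open>A discrete mean value property. Summing the expansion over the points
  \<open>\<nu> + h * w ^ k\<close> kills the terms with \<open>0 < j < n\<close>, and since
  \<open>(h * w ^ k) ^ n = h ^ n\<close>, the remainders combine into a multiple of the same sum of
  values.\<close>

lemma pseudo_resolvent_mean:
  fixes n :: nat
  assumes res: "\<And>\<nu> \<mu>. N (y \<nu> - y \<mu> - (\<mu> - \<nu>) *\<^sub>C (y \<nu> * y \<mu>)) = 0" and n: "n > 0"
  shows "n * N (y \<nu>) \<le>
    (1 + (cmod h * N (y \<nu>)) ^ n) * (\<Sum>k<n. N (y (\<nu> + h * cis (2 * pi / n) ^ k)))"
proof -
  define w where "w = cis (2 * pi / n)"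
  define z where "z k = y (\<nu> + h * w ^ k)" for k
  let ?v = "y \<nu>"
  have wn: "(w ^ k) ^ n = 1" for k
    using n by (simp add: w_def Complex.DeMoivre flip: power_mult) 
       (metis cis_multiple_2pi Ints_of_nat mult.commute)
  have "N (\<Sum>k<n. z k - ((\<Sum>j<n. (- (h * w ^ k)) ^ j *\<^sub>C ?v ^ Suc j)
    + (- (h * w ^ k)) ^ n *\<^sub>C (z k * ?v ^ n))) = 0"
    unfolding z_def by (intro null_sum pseudo_resolvent_expansion res)
  also have "(\<Sum>k<n. z k - ((\<Sum>j<n. (- (h * w ^ k)) ^ j *\<^sub>C ?v ^ Suc j)
      + (- (h * w ^ k)) ^ n *\<^sub>C (z k * ?v ^ n)))
    = (\<Sum>k<n. z k) - (\<Sum>k<n. \<Sum>j<n. (- (h * w ^ k)) ^ j *\<^sub>C ?v ^ Suc j)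
      - (- h) ^ n *\<^sub>C ((\<Sum>k<n. z k) * ?v ^ n)"
  proof -
    have "(- (h * w ^ k)) ^ n = (- h) ^ n" for k
      using wn[of k] power_mult_distrib[of "- h" "w ^ k" n] by simp
    thus ?thesis
      by (simp add: sum_subtractf sum.distrib cvec.scale_sum_right sum_distrib_right algebra_simps)
  qed
  also have "(\<Sum>k<n. \<Sum>j<n. (- (h * w ^ k)) ^ j *\<^sub>C ?v ^ Suc j)
    = (\<Sum>j<n. ((- h) ^ j * (\<Sum>k<n. (w ^ k) ^ j)) *\<^sub>C ?v ^ Suc j)"
  proof -
    have "(- (h * w ^ k)) ^ j = (- h) ^ j * (w ^ k) ^ j" for k j
      using power_mult_distrib[of "- h" "w ^ k" j] by simp
    thus ?thesis
      by (subst sum.swap) (simp add: cvec.scale_sum_left sum_distrib_left del: power_Suc)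
  qed
  also have "\<dots> = (\<Sum>j<n. (if j = 0 then of_nat n *\<^sub>C ?v else 0))"
    by (intro sum.cong refl) (simp add: w_def sum_cis_roots_unity)
  also have "\<dots> = of_nat n *\<^sub>C ?v"
    using n by (simp add: sum.delta)
  finally have "N ((\<Sum>k<n. z k) - (- h) ^ n *\<^sub>C ((\<Sum>k<n. z k) * ?v ^ n) - of_nat n *\<^sub>C ?v) = 0"
    by (simp add: algebra_simps)
  hence "n * N ?v = N ((\<Sum>k<n. z k) - (- h) ^ n *\<^sub>C ((\<Sum>k<n. z k) * ?v ^ n))"
    using null_cong[of _ "of_nat n *\<^sub>C ?v"] by (simp add: scale)
  also have "\<dots> \<le> N (\<Sum>k<n. z k) + cmod h ^ n * N ((\<Sum>k<n. z k) * ?v ^ n)"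
    using diff_le[of "\<Sum>k<n. z k" "(- h) ^ n *\<^sub>C ((\<Sum>k<n. z k) * ?v ^ n)"] by (simp add: scale norm_power)
  also have "\<dots> \<le> N (\<Sum>k<n. z k) + cmod h ^ n * (N (\<Sum>k<n. z k) * N ?v ^ n)"
    by (intro add_left_mono mult_left_mono mult_power_le) auto
  also have "\<dots> = (1 + (cmod h * N ?v) ^ n) * N (\<Sum>k<n. z k)"
    by (simp add: algebra_simps power_mult_distrib)
  also have "\<dots> \<le> (1 + (cmod h * N ?v) ^ n) * (\<Sum>k<n. N (z k))"
    by (intro mult_left_mono sum_le) auto
  finally show ?thesis
    by (simp add: z_def w_def)
qed

text \<open>The point \<open>\<nu> + h\<close> is the term \<open>k = 0\<close> of the mean. If the
  value there fell short of the maximum by \<open>M - u\<close>, the sum over the \<open>n\<close>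
  points would fall short by at least as much, whereas the mean property allows only
  \<open>M * n * q ^ n\<close>, which tends to 0.\<close>

lemma pseudo_resolvent_max_propagates:
  assumes res: "\<And>\<nu> \<mu>. N (y \<nu> - y \<mu> - (\<mu> - \<nu>) *\<^sub>C (y \<nu> * y \<mu>)) = 0"
    and max: "\<And>\<mu>. N (y \<mu>) \<le> N (y \<nu>)" and h: "cmod h * N (y \<nu>) < 1"
  shows "N (y (\<nu> + h)) = N (y \<nu>)"
proof -
  define M q u where "M = N (y \<nu>)" and "q = cmod h * M" and "u = N (y (\<nu> + h))"
  have q: "0 \<le> q" "q < 1"
    using h by (auto simp: q_def M_def)
  have "M - u \<le> M * (n * q ^ n)" if "n > 0" for n :: nat
  proof -
    let ?w = "cis (2 * pi / n)"
    have "n * M \<le> (1 + q ^ n) * (\<Sum>k<n. N (y (\<nu> + h * ?w ^ k)))"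
      unfolding q_def M_def by (rule pseudo_resolvent_mean[OF res that])
    also have "(\<Sum>k<n. N (y (\<nu> + h * ?w ^ k))) \<le> (\<Sum>k<n. M - (if k = 0 then M - u else 0))"
      using max by (intro sum_mono) (auto simp: M_def u_def)
    also have "(\<Sum>k<n. M - (if k = 0 then M - u else 0)) = n * M - (M - u)"
      using that by (simp add: sum_subtractf sum.delta)
    finally have "n * M \<le> (1 + q ^ n) * (n * M - (M - u))"
      using q by (simp add: mult_left_mono)
    moreover have "0 \<le> q ^ n * (M - u)"
      using q max by (simp add: M_def u_def)
    ultimately show ?thesis
      by (simp add: algebra_simps)
  qed
  hence "\<forall>\<^sub>F n in sequentially. M - u \<le> M * (real n * q ^ n)"
    using eventually_gt_at_top by (rule eventually_mono[rotated]) 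
  moreover have "(\<lambda>n. M * (real n * q ^ n)) \<longlonglongrightarrow> M * 0"
    using q by (intro tendsto_mult_left powser_times_n_limit_0) auto
  ultimately have "M - u \<le> M * 0"
    by (intro tendsto_le[OF sequentially_bot _ tendsto_const]) auto
  thus ?thesis
    using max[of "\<nu> + h"] by (simp add: M_def u_def)
qed

lemma pseudo_resolvent_continuous:
  assumes res: "\<And>\<nu> \<mu>. N (y \<nu> - y \<mu> - (\<mu> - \<nu>) *\<^sub>C (y \<nu> * y \<mu>)) = 0"
  shows "isCont (\<lambda>\<nu>. N (y \<nu>)) \<nu>"
proof -
  define M where "M = N (y \<nu>)"
  \<comment> \<open>The resolvent identity bounds the difference by a multiple of
    \<open>N (y \<mu>)\<close>, whose size is not yet known. Half of it is absorbed first, which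
    gives \<open>N (y \<mu>) \<le> 2 * M\<close>, and this is fed back into the estimate.\<close>
  have bound: "\<bar>N (y \<mu>) - M\<bar> \<le> cmod (\<mu> - \<nu>) * (2 * M * M)" if "cmod (\<mu> - \<nu>) * M \<le> 1 / 2" for \<mu>
  proof -
    have "N (y \<nu> - y \<mu>) = N ((\<mu> - \<nu>) *\<^sub>C (y \<nu> * y \<mu>))"
      by (intro null_cong res)
    also have "\<dots> \<le> cmod (\<mu> - \<nu>) * (M * N (y \<mu>))"
      unfolding scale M_def by (intro mult_left_mono mult_le) auto
    finally have *: "\<bar>N (y \<mu>) - M\<bar> \<le> cmod (\<mu> - \<nu>) * (M * N (y \<mu>))"
      using abs_diff_le[of "y \<nu>" "y \<mu>"] by (simp add: M_def)
    also have "\<dots> \<le> 1 / 2 * N (y \<mu>)"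
      using mult_right_mono[OF that nonneg[of "y \<mu>"]] by (simp add: mult_ac)
    finally have "N (y \<mu>) \<le> 2 * M"
      by linarith
    hence "cmod (\<mu> - \<nu>) * (M * N (y \<mu>)) \<le> cmod (\<mu> - \<nu>) * (M * (2 * M))"
      by (intro mult_left_mono) (auto simp: M_def)
    with * show ?thesis by (simp add: mult_ac)
  qed
  have "((\<lambda>\<mu>. cmod (\<mu> - \<nu>) * M) \<longlongrightarrow> cmod (\<nu> - \<nu>) * M) (at \<nu>)"
    by (intro tendsto_intros)
  hence "\<forall>\<^sub>F \<mu> in at \<nu>. cmod (\<mu> - \<nu>) * M < 1 / 2"
    by (rule order_tendstoD(2)) simp
  hence "\<forall>\<^sub>F \<mu> in at \<nu>. norm (N (y \<mu>) - M) \<le> cmod (\<mu> - \<nu>) * (2 * M * M)"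
    by (rule eventually_mono) (simp add: bound)
  moreover have "((\<lambda>\<mu>. cmod (\<mu> - \<nu>) * (2 * M * M)) \<longlongrightarrow> cmod (\<nu> - \<nu>) * (2 * M * M)) (at \<nu>)"
    by (intro tendsto_intros)
  ultimately have "((\<lambda>\<mu>. N (y \<mu>) - M) \<longlongrightarrow> 0) (at \<nu>)"
    using Lim_null_comparison[of "\<lambda>\<mu>. N (y \<mu>) - M"] by simp
  thus ?thesis
    by (simp add: isCont_def M_def LIM_zero_iff)
qed

text \<open>
  Liouville's theorem by the maximum principle, with means over roots of unity in place of
  contour integrals: only finite sums occur, so no completeness modulo the kernel of \<open>N\<close> is
  needed and the result applies to quotient seminorms.
\<close>

lemma pseudo_resolvent_null:
  assumes res: "\<And>\<nu> \<mu>. N (y \<nu> - y \<mu> - (\<mu> - \<nu>) *\<^sub>C (y \<nu> * y \<mu>)) = 0"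
    and lim: "((\<lambda>\<nu>. N (y \<nu>)) \<longlongrightarrow> 0) at_infinity"
  shows "N (y \<nu>) = 0"
proof (rule ccontr)
  assume "N (y \<nu>) \<noteq> 0"
  hence pos: "N (y \<nu>) > 0"
    using nonneg[of "y \<nu>"] by linarith
  have "\<forall>\<^sub>F \<mu> in at_infinity. N (y \<mu>) < N (y \<nu>)"
    using order_tendstoD(2)[OF lim pos] .
  then obtain R where R: "\<And>\<mu>. R \<le> cmod \<mu> \<Longrightarrow> N (y \<mu>) < N (y \<nu>)"
    by (auto simp: eventually_at_infinity)
  have "\<nu> \<in> cball 0 R"
    using R[of \<nu>] by (force simp: not_le)
  have "continuous_on (cball 0 R) (\<lambda>\<mu>. N (y \<mu>))"
    by (intro continuous_at_imp_continuous_on ballI pseudo_resolvent_continuous res)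
  with \<open>\<nu> \<in> cball 0 R\<close> obtain \<nu>0 where \<nu>0: "\<And>\<mu>. \<mu> \<in> cball 0 R \<Longrightarrow> N (y \<mu>) \<le> N (y \<nu>0)"
    using continuous_attains_sup[of "cball 0 R" "\<lambda>\<mu>. N (y \<mu>)"] compact_cball by blast
  have max: "N (y \<mu>) \<le> N (y \<nu>0)" for \<mu>
    using R[of \<mu>] \<nu>0[of \<mu>] \<nu>0[OF \<open>\<nu> \<in> cball 0 R\<close>] by (cases "\<mu> \<in> cball 0 R") (auto simp: not_le)
  define M where "M = N (y \<nu>0)"
  have "M > 0"
    using pos max[of \<nu>] by (simp add: M_def)
  \<comment> \<open>The step width \<open>1 / (2 * M)\<close> makes
    \<open>cmod h * N (y \<nu>)\<close> equal to \<open>1 / 2\<close>. The maximum is thus carried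
    along a ray until it leaves the disc outside which all values are smaller.\<close>
  have step: "N (y (\<nu>0 + of_nat k * of_real (1 / (2 * M)))) = M" for k
  proof (induction k)
    case (Suc k)
    let ?\<mu> = "\<nu>0 + of_nat k * of_real (1 / (2 * M))"
    have "N (y (?\<mu> + of_real (1 / (2 * M)))) = N (y ?\<mu>)"
      using Suc max \<open>M > 0\<close>
      by (intro pseudo_resolvent_max_propagates res) (auto simp: M_def norm_divide)
    thus ?case
      using Suc by (simp add: algebra_simps add_divide_distrib)
  qed (simp add: M_def)
  obtain k :: nat where k: "real k > (R + cmod \<nu>0) * (2 * M)"
    using reals_Archimedean2 by blast
  have "R + cmod \<nu>0 \<le> cmod (of_nat k * of_real (1 / (2 * M)))"
    using k \<open>M > 0\<close> by (simp add: norm_mult norm_divide field_simps)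
  hence "R \<le> cmod (\<nu>0 + of_nat k * of_real (1 / (2 * M)))"
    using norm_diff_ineq[of "of_nat k * of_real (1 / (2 * M))" \<nu>0] by (simp add: add.commute)
  from R[OF this] step[of k] max[of \<nu>] show False
    by (simp add: M_def)
qed

text \<open>Inverses of \<open>\<nu> p - x\<close> for all complex \<nu> form a pseudo-resolvent
  that decays like the inverse of \<open>norm \<nu>\<close>. By Liouville it is null, and so is
  \<open>p\<close>, which is its product with \<open>- x\<close> at \<nu> = 0. Read
  contrapositively, spectra in corners are nonempty.\<close>

lemma corner_spectrum_nonempty:
  assumes left: "\<And>\<nu>. N (y \<nu> * (\<nu> *\<^sub>C p - x) - p) = 0"
    and right: "\<And>\<nu>. N ((\<nu> *\<^sub>C p - x) * y \<nu> - p) = 0"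
    and py: "\<And>\<nu>. N (p * y \<nu> - y \<nu>) = 0" and yp: "\<And>\<nu>. N (y \<nu> * p - y \<nu>) = 0"
  shows "N p = 0"
proof -
  have res: "N (y \<nu> - y \<mu> - (\<mu> - \<nu>) *\<^sub>C (y \<nu> * y \<mu>)) = 0" for \<nu> \<mu>
  proof -
    \<comment> \<open>The usual derivation of the resolvent identity with its error terms collected:
      multiples of the four corner equations add up to the negative of that identity.\<close>
    have "N (y \<nu> * ((\<mu> *\<^sub>C p - x) * y \<mu> - p) - (y \<nu> * (\<nu> *\<^sub>C p - x) - p) * y \<mu>
       + (y \<nu> * p - y \<nu>) - (p * y \<mu> - y \<mu>)
       - (\<mu> - \<nu>) *\<^sub>C ((y \<nu> * p - y \<nu>) * y \<mu>)) = 0" (is "N ?t = 0")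
      by (intro null_add null_diff null_mult null_scale disjI1[OF left] disjI1[OF yp]
          disjI2[OF right] py yp)
    moreover have "?t = - (y \<nu> - y \<mu> - (\<mu> - \<nu>) *\<^sub>C (y \<nu> * y \<mu>))"
      by (simp add: algebra_simps scaleC_simps)
    ultimately show ?thesis
      by (simp only: minus)
  qed
  \<comment> \<open>The threshold gives \<open>N x \<le> norm \<nu> / 2\<close>, so the term
    \<open>N x * N (y \<nu>)\<close> can be absorbed on the left; the summand 1 keeps \<nu> away
    from 0.\<close>
  have bound: "norm (N (y \<nu>)) \<le> 2 * N p * inverse (norm \<nu>)" if "2 * N x + 1 \<le> norm \<nu>" for \<nu>
  proof -
    have "N (((\<nu> *\<^sub>C p - x) * y \<nu> - p) - \<nu> *\<^sub>C (p * y \<nu> - y \<nu>)) = 0"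
      by (intro null_diff null_scale right py)
    hence "N (\<nu> *\<^sub>C y \<nu> - (p + x * y \<nu>)) = 0"
      by (simp add: algebra_simps scaleC_simps)
    hence "norm \<nu> * N (y \<nu>) = N (p + x * y \<nu>)"
      using null_cong[of "\<nu> *\<^sub>C y \<nu>" "p + x * y \<nu>"] by (simp add: scale)
    also have "\<dots> \<le> N p + N x * N (y \<nu>)"
      using add_le[of p "x * y \<nu>"] mult_le[of x "y \<nu>"] by linarith
    also have "N x * N (y \<nu>) \<le> norm \<nu> / 2 * N (y \<nu>)"
      using that by (intro mult_right_mono) auto
    finally have "norm \<nu> * N (y \<nu>) \<le> 2 * N p"
      by simp
    moreover have "norm \<nu> > 0"
      using that nonneg[of x] by linarith
    ultimately show ?thesis
      by (simp add: field_simps)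
  qed
  have "N (y \<nu>) = 0" for \<nu>
  proof (rule pseudo_resolvent_null[of y, OF res])
    have "((\<lambda>\<nu>::complex. 2 * N p * inverse (norm \<nu>)) \<longlongrightarrow> 2 * N p * 0) at_infinity"
      by (intro tendsto_mult_left tendsto_inverse_0_at_top filterlim_norm_at_top)
    moreover have "\<forall>\<^sub>F \<nu> in at_infinity. norm (N (y \<nu>)) \<le> 2 * N p * inverse (norm \<nu>)"
      using bound unfolding eventually_at_infinity by blast
    ultimately show "((\<lambda>\<nu>. N (y \<nu>)) \<longlongrightarrow> 0) at_infinity"
      using Lim_null_comparison[of "\<lambda>\<nu>. N (y \<nu>)"] by simp
  qed
  hence "N ((0 *\<^sub>C p - x) * y 0) = 0"
    by (intro null_mult) simp
  thus ?thesis
    using null_cong[OF right[of 0]] by simp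
qed

end


section \<open>Minimal idempotents and frames\<close>

text \<open>The condition \<open>e A e = \<complex> e\<close> builds the conclusion of Gelfand and
  Mazur into the notion. In a semisimple algebra these are exactly the idempotents that generate
  minimal right ideals.\<close>

definition minimal_idempotent :: "'a::complex_banach_algebra \<Rightarrow> bool" where
  "minimal_idempotent e \<longleftrightarrow> e \<noteq> 0 \<and> e * e = e \<and> (\<forall>x. \<exists>a. e * x * e = a *\<^sub>C e)"

lemma minimal_idempotentE:
  assumes "minimal_idempotent e"
  obtains a where "e * x * e = a *\<^sub>C e"
  using assms by (auto simp: minimal_idempotent_def)

text \<open>Since \<open>(e * v) * (u * e) = a *\<^sub>C e\<close>, the elements
  \<open>u * e\<close> and \<open>e * v\<close> are inverse to each other up to the scalar
  \<open>a\<close>, and they carry \<open>e\<close> to an equivalent idempotent.\<close>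

lemma minimal_idempotent_transport:
  assumes e: "minimal_idempotent e" and a: "e * (v * u) * e = a *\<^sub>C e" "a \<noteq> 0"
  shows "minimal_idempotent ((1 / a) *\<^sub>C (u * e * v))"
  unfolding minimal_idempotent_def
proof (intro conjI allI)
  have aux: "e * v * (u * e) = a *\<^sub>C e"
    using a by (simp add: mult.assoc)
  have "(u * e * v) * (u * e * v) = u * (e * v * (u * e)) * v"
    by (simp add: mult.assoc)
  also have "\<dots> = a *\<^sub>C (u * e * v)"
    by (simp add: aux scaleC_simps)
  finally have sq: "(u * e * v) * (u * e * v) = a *\<^sub>C (u * e * v)" .
  thus "(1 / a) *\<^sub>C (u * e * v) * (1 / a) *\<^sub>C (u * e * v) = (1 / a) *\<^sub>C (u * e * v)"
    using a by (simp add: scaleC_simps)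
  show "(1 / a) *\<^sub>C (u * e * v) \<noteq> 0"
  proof
    assume "(1 / a) *\<^sub>C (u * e * v) = 0"
    hence "e * v * (u * e * v) * u * e = 0"
      using a by simp
    hence "(e * v * (u * e)) * (v * (u * e)) = 0"
      by (simp add: mult.assoc)
    hence "(a *\<^sub>C e) * (v * (u * e)) = 0"
      by (simp only: aux)
    hence "a *\<^sub>C (e * v * (u * e)) = 0"
      by (simp add: scaleC_simps mult.assoc)
    hence "a *\<^sub>C a *\<^sub>C e = 0"
      by (simp only: aux)
    thus False
      using e a by (simp add: minimal_idempotent_def)
  qed
  fix x
  obtain b where b: "e * (v * x * u) * e = b *\<^sub>C e"
    using e by (rule minimal_idempotentE)
  have "(u * e * v) * x * (u * e * v) = u * (e * (v * x * u) * e) * v"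
    by (simp add: mult.assoc)
  hence "(u * e * v) * x * (u * e * v) = b *\<^sub>C (u * e * v)"
    by (simp add: b scaleC_simps)
  thus "\<exists>c. (1 / a) *\<^sub>C (u * e * v) * x * (1 / a) *\<^sub>C (u * e * v) = c *\<^sub>C (1 / a) *\<^sub>C (u * e * v)"
    by (intro exI[of _ "b / a"]) (simp add: scaleC_simps mult_ac)
qed

text \<open>The analogue of the diagonal matrix units. Orthogonality holds in both orders because
  both pairs are quantified, so \<open>\<Sum>E\<close> is an idempotent; its rank will be
  \<open>card E\<close>.\<close>

definition frame :: "'a::complex_banach_algebra set \<Rightarrow> bool" where
  "frame E \<longleftrightarrow> finite E \<and> (\<forall>e\<in>E. minimal_idempotent e) \<and> (\<forall>e\<in>E. \<forall>f\<in>E. e \<noteq> f \<longrightarrow> e * f = 0)"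

lemma frame_empty [simp]: "frame {}"
  by (simp add: frame_def)

lemma frame_mult_sum:
  assumes "frame E" "e \<in> E"
  shows "e * \<Sum>E = e" "\<Sum>E * e = e"
proof -
  have "e * \<Sum>E = (\<Sum>f\<in>E. if f = e then e else 0)"
    unfolding sum_distrib_left using assms
    by (intro sum.cong) (auto simp: frame_def minimal_idempotent_def)
  moreover have "\<Sum>E * e = (\<Sum>f\<in>E. if f = e then e else 0)"
    unfolding sum_distrib_right using assms
    by (intro sum.cong) (auto simp: frame_def minimal_idempotent_def)
  ultimately show "e * \<Sum>E = e" "\<Sum>E * e = e"
    using assms by (simp_all add: frame_def sum.delta)
qed

lemma frame_sum_absorb:
  assumes "frame E'" "E \<subseteq> E'"
  shows "\<Sum>E * \<Sum>E' = \<Sum>E" "\<Sum>E' * \<Sum>E = \<Sum>E"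
proof -
  have "\<Sum>E * \<Sum>E' = (\<Sum>e\<in>E. e * \<Sum>E')" "\<Sum>E' * \<Sum>E = (\<Sum>e\<in>E. \<Sum>E' * e)"
    by (simp add: sum_distrib_right) (simp add: sum_distrib_left)
  thus "\<Sum>E * \<Sum>E' = \<Sum>E" "\<Sum>E' * \<Sum>E = \<Sum>E"
    using assms by (auto simp: frame_mult_sum subset_iff intro!: sum.cong)
qed

lemma frame_sum_idem: "frame E \<Longrightarrow> \<Sum>E * \<Sum>E = \<Sum>E"
  by (simp add: frame_sum_absorb)

lemma frame_mono_left:
  assumes "frame E'" "E \<subseteq> E'" "\<Sum>E * x = x"
  shows "\<Sum>E' * x = x"
  by (metis assms frame_sum_absorb(2) mult.assoc)

lemma frame_mono_right:
  assumes "frame E'" "E \<subseteq> E'" "x * \<Sum>E = x"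
  shows "x * \<Sum>E' = x"
  by (metis assms frame_sum_absorb(1) mult.assoc)

text \<open>Frames are sets, so \<open>h \<notin> E\<close> is what ensures that the sum really
  gains the summand \<open>h\<close>.\<close>

lemma frame_insert:
  assumes E: "frame E" and h: "minimal_idempotent h" "h * \<Sum>E = 0" "\<Sum>E * h = 0"
  shows "frame (insert h E)" "h \<notin> E"
proof -
  have "h * e = 0" "e * h = 0" if "e \<in> E" for e
  proof -
    have "h * e = (h * \<Sum>E) * e" "e * h = e * (\<Sum>E * h)"
      using frame_mult_sum[OF E that] by (metis mult.assoc)+
    thus "h * e = 0" "e * h = 0"
      using h by simp_all
  qed
  thus "frame (insert h E)" "h \<notin> E"
    using E h by (auto simp: frame_def minimal_idempotent_def)
qed

text \<open>The two-sided ideal generated by the minimal idempotents, which will turn out to be the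
  socle. It grows by one term \<open>u * e * v\<close> at a time, so that an induction has to handle
  only one minimal idempotent; scalars are absorbed in \<open>u\<close>.\<close>

inductive_set soc_span :: "'a::complex_banach_algebra set" where
  zero: "0 \<in> soc_span"
| add: "x \<in> soc_span \<Longrightarrow> minimal_idempotent e \<Longrightarrow> x + u * e * v \<in> soc_span"

lemma soc_span_add:
  assumes "x \<in> soc_span" "y \<in> soc_span"
  shows "x + y \<in> soc_span"
  using assms(2,1) by (induction y rule: soc_span.induct)
    (auto simp flip: add.assoc intro: soc_span.intros)

lemma soc_span_mult: "x \<in> soc_span \<Longrightarrow> a * x * b \<in> soc_span"
proof (induction x rule: soc_span.induct)
  case (add x e u v)
  have "a * (x + u * e * v) * b = a * x * b + (a * u) * e * (v * b)"
    by (simp add: algebra_simps)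
  thus ?case
    using add by (auto intro: soc_span.intros)
qed (auto intro: soc_span.intros)

lemma soc_span_mult_left: "x \<in> soc_span \<Longrightarrow> a * x \<in> soc_span"
  using soc_span_mult[of x a 1] by simp

lemma soc_span_mult_right: "x \<in> soc_span \<Longrightarrow> x * b \<in> soc_span"
  using soc_span_mult[of x 1 b] by simp

lemma soc_span_uminus: "x \<in> soc_span \<Longrightarrow> - x \<in> soc_span"
  using soc_span_mult_left[of x "- 1"] by simp

lemma soc_span_diff: "x \<in> soc_span \<Longrightarrow> y \<in> soc_span \<Longrightarrow> x - y \<in> soc_span"
  using soc_span_add[OF _ soc_span_uminus, of x y] by simp

lemma minimal_idempotent_soc_span: "minimal_idempotent e \<Longrightarrow> e \<in> soc_span"
  using soc_span.add[OF soc_span.zero, of e 1 1] by simp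

lemma soc_span_sum: "(\<And>i. i \<in> I \<Longrightarrow> f i \<in> soc_span) \<Longrightarrow> sum f I \<in> soc_span"
  by (induction I rule: infinite_finite_induct) (auto intro: soc_span_add soc_span.zero)

lemma frame_sum_soc_span: "frame E \<Longrightarrow> \<Sum>E \<in> soc_span"
  by (auto simp: frame_def intro: soc_span_sum minimal_idempotent_soc_span)


section \<open>The socle of a semisimple algebra\<close>

context
  assumes semisimple: "jacobson_radical = ({0} :: 'a::complex_banach_algebra set)"
begin

text \<open>If \<open>x\<close> lies outside a maximal left ideal \<open>M\<close>, then
  \<open>M + A x\<close> is the whole algebra and \<open>1 = m + a * x\<close>. Multiplying by
  \<open>x\<close> from the left gives \<open>x = x * m \<in> M\<close>, because
  \<open>x * a * x = 0\<close>.\<close>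

lemma semiprime:
  fixes x :: 'a
  assumes x: "\<And>a. x * a * x = 0"
  shows "x = 0"
proof (rule ccontr)
  assume "x \<noteq> 0"
  hence "x \<notin> jacobson_radical"
    unfolding semisimple by simp
  then obtain M where M: "maximal_left_ideal M" "x \<notin> M"
    by (auto simp: jacobson_radical_def)
  have ideal: "left_ideal M"
    using M by (simp add: maximal_left_ideal_def)
  define L where "L = {m + a * x | m a. m \<in> M}"
  have "left_ideal L"
    unfolding left_ideal_def
  proof (intro conjI ballI allI)
    show "0 \<in> L"
      using ideal unfolding L_def left_ideal_def by (auto intro!: exI[of _ 0])
  next
    fix y z assume "y \<in> L" "z \<in> L"
    then obtain m a m' a' where *: "y = m + a * x" "z = m' + a' * x" "m \<in> M" "m' \<in> M"
      unfolding L_def by blast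
    hence "y + z = (m + m') + (a + a') * x" "m + m' \<in> M"
      using ideal by (simp_all add: algebra_simps left_ideal_def)
    thus "y + z \<in> L"
      unfolding L_def by blast
  next
    fix y b assume "y \<in> L"
    then obtain m a where *: "y = m + a * x" "m \<in> M"
      unfolding L_def by blast
    hence "b * y = b * m + (b * a) * x" "b * m \<in> M"
      using ideal by (simp_all add: algebra_simps left_ideal_def)
    thus "b * y \<in> L"
      unfolding L_def by blast
  qed
  moreover have "M \<subseteq> L"
  proof
    fix m assume "m \<in> M"
    moreover have "m = m + 0 * x" by simp
    ultimately show "m \<in> L"
      unfolding L_def by blast
  qed
  moreover have "x \<in> L"
  proof -
    have "x = 0 + 1 * x" "0 \<in> M"
      using ideal by (simp_all add: left_ideal_def)
    thus ?thesis
      unfolding L_def by blast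
  qed
  ultimately have "L = UNIV"
    using M unfolding maximal_left_ideal_def by blast
  hence "1 \<in> L"
    by simp
  then obtain m a where ma: "1 = m + a * x" "m \<in> M"
    unfolding L_def by blast
  have "x = x * (m + a * x)"
    using ma by simp
  also have "\<dots> = x * m"
    using x[of a] by (simp add: distrib_left mult.assoc)
  also have "\<dots> \<in> M"
    using ideal ma by (simp add: left_ideal_def)
  finally show False
    using M by simp
qed

text \<open>Supplies the nonzero scalar that \<open>minimal_idempotent_transport\<close> asks for:
  some \<open>b\<close> keeps \<open>(u e v) b (u e v)\<close> nonzero, and the middle of this
  product lies in \<open>\<complex> e\<close>.\<close>

lemma semiprime_minimal_idempotent:
  fixes e u v :: 'a
  assumes e: "minimal_idempotent e" and ne: "u * e * v \<noteq> 0"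
  obtains b a where "e * v * b * u * e = a *\<^sub>C e" "a \<noteq> 0"
proof -
  obtain b where b: "(u * e * v) * b * (u * e * v) \<noteq> 0"
    using semiprime[of "u * e * v"] ne by blast
  obtain a where a: "e * (v * b * u) * e = a *\<^sub>C e"
    using e by (rule minimal_idempotentE)
  have "a \<noteq> 0"
  proof
    assume "a = 0"
    hence "u * (e * (v * b * u) * e) * v = 0"
      using a by simp
    thus False
      using b by (simp add: mult.assoc)
  qed
  with a that[of b a] show ?thesis
    by (simp add: mult.assoc)
qed

text \<open>A Gram-Schmidt step. The part \<open>(1 - g) w e\<close> that \<open>g = \<Sum>E\<close>
  misses, if nonzero, generates the same right ideal as a minimal idempotent \<open>h\<close>; the
  second factor \<open>1 - g\<close> in \<open>h\<close> makes \<open>h\<close> orthogonal to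
  \<open>g\<close> on the other side as well. The last clause records where \<open>h\<close> lies,
  for frames that have to stay inside a given right ideal.\<close>

lemma frame_extend_left:
  fixes e w :: 'a
  assumes E: "frame E" and e: "minimal_idempotent e"
  obtains E' where "frame E'" "E \<subseteq> E'" "\<Sum>E' * (w * e) = w * e" "card E' \<le> Suc (card E)"
    "\<And>h. h \<in> E' \<Longrightarrow> h \<in> E \<or> (\<exists>b. h = (1 - \<Sum>E) * (w * e) * b)"
proof (cases "(1 - \<Sum>E) * (w * e) = 0")
  case True
  thus ?thesis
    using that[of E] E by (simp add: algebra_simps)
next
  case False
  define g where "g = \<Sum>E"
  have g: "g * g = g"
    unfolding g_def using E by (rule frame_sum_idem)
  have "((1 - g) * w) * e * 1 \<noteq> 0"
    using False by (simp add: mult.assoc g_def)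
  then obtain b a where a: "e * 1 * b * ((1 - g) * w) * e = a *\<^sub>C e" "a \<noteq> 0"
    by (rule semiprime_minimal_idempotent[OF e])
  have g1: "(1 - g) * (1 - g) = 1 - g" "g * (1 - g) = 0" "(1 - g) * g = 0"
    using g by (simp_all add: algebra_simps)
  have g2: "(1 - g) * ((1 - g) * x) = (1 - g) * x" "g * ((1 - g) * x) = 0" for x
    using g1 by (metis mult.assoc mult_zero_left)+
  define h where "h = (1 / a) *\<^sub>C ((1 - g) * w * e * (b * (1 - g)))"
  have eb: "e * (b * ((1 - g) * (w * e))) = a *\<^sub>C e"
    using a by (simp add: mult.assoc)
  have "e * ((b * (1 - g)) * ((1 - g) * w)) * e = a *\<^sub>C e"
    using a by (simp add: mult.assoc g2)
  hence h: "minimal_idempotent h"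
    unfolding h_def using a e by (intro minimal_idempotent_transport) auto
  have gh: "h * g = 0" "g * h = 0"
    by (simp_all add: h_def scaleC_simps mult.assoc g1 g2)
  have E': "frame (insert h E)" "h \<notin> E"
    using frame_insert[OF E h] gh by (simp_all add: g_def)
  have "h * (w * e) = (1 - g) * (w * e)"
    using a by (simp add: h_def scaleC_simps mult.assoc eb)
  hence "\<Sum>(insert h E) * (w * e) = w * e"
    using E E' by (simp add: frame_def algebra_simps g_def)
  moreover have "h = (1 - \<Sum>E) * (w * e) * ((1 / a) *\<^sub>C (b * (1 - g)))"
    by (simp add: h_def scaleC_simps mult.assoc g_def)
  ultimately show ?thesis
    using that[of "insert h E"] E' E by (auto simp: frame_def card_insert_if)
qed

text \<open>The mirror image of the previous step, for the part of \<open>e * w\<close> that is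
  missed from the right.\<close>

lemma frame_extend_right:
  fixes e w :: 'a
  assumes E: "frame E" and e: "minimal_idempotent e"
  obtains E' where "frame E'" "E \<subseteq> E'" "(e * w) * \<Sum>E' = e * w"
proof (cases "e * w * (1 - \<Sum>E) = 0")
  case True
  thus ?thesis
    using that[of E] E by (simp add: right_diff_distrib)
next
  case False
  define g where "g = \<Sum>E"
  have g: "g * g = g"
    unfolding g_def using E by (rule frame_sum_idem)
  have "1 * e * (w * (1 - g)) \<noteq> 0"
    using False by (simp add: mult.assoc g_def)
  then obtain b a where a: "e * (w * (1 - g)) * b * 1 * e = a *\<^sub>C e" "a \<noteq> 0"
    by (rule semiprime_minimal_idempotent[OF e])
  have g1: "(1 - g) * (1 - g) = 1 - g" "g * (1 - g) = 0" "(1 - g) * g = 0"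
    using g by (simp_all add: algebra_simps)
  have g2: "(1 - g) * ((1 - g) * x) = (1 - g) * x" "g * ((1 - g) * x) = 0" for x
    using g1 by (metis mult.assoc mult_zero_left)+
  define h where "h = (1 / a) *\<^sub>C ((1 - g) * b * e * (w * (1 - g)))"
  have eb: "e * (w * ((1 - g) * (b * e))) = a *\<^sub>C e"
    using a by (simp add: mult.assoc)
  have eb': "e * (w * ((1 - g) * (b * (e * x)))) = a *\<^sub>C (e * x)" for x
    using arg_cong[OF eb, of "\<lambda>t. t * x"] by (simp add: mult.assoc scaleC_simps)
  have "e * ((w * (1 - g)) * ((1 - g) * b)) * e = a *\<^sub>C e"
    using a by (simp add: mult.assoc g2)
  hence h: "minimal_idempotent h"
    unfolding h_def using a e by (intro minimal_idempotent_transport) auto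
  have gh: "h * g = 0" "g * h = 0"
    by (simp_all add: h_def scaleC_simps mult.assoc g1 g2)
  have E': "frame (insert h E)" "h \<notin> E"
    using frame_insert[OF E h] gh by (simp_all add: g_def)
  have "(e * w) * h = (e * w) * (1 - g)"
    using a by (simp add: h_def scaleC_simps mult.assoc eb')
  hence "(e * w) * \<Sum>(insert h E) = e * w"
    using E E' by (simp add: frame_def algebra_simps g_def)
  thus ?thesis
    using that[of "insert h E"] E' by auto
qed

lemma frame_extend:
  fixes x :: 'a
  assumes "x \<in> soc_span" "frame E"
  shows "\<exists>E'. frame E' \<and> E \<subseteq> E' \<and> \<Sum>E' * x = x \<and> x * \<Sum>E' = x"
  using assms(1)
proof (induction x rule: soc_span.induct)
  case zero
  thus ?case using assms by auto
next
  case (add x e u v)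
  obtain E1 where E1: "frame E1" "E \<subseteq> E1" "\<Sum>E1 * x = x" "x * \<Sum>E1 = x"
    using add.IH by blast
  obtain E2 where E2: "frame E2" "E1 \<subseteq> E2" "\<Sum>E2 * (u * e) = u * e"
    using frame_extend_left[OF E1(1) add.hyps(2)] by metis
  obtain E3 where E3: "frame E3" "E2 \<subseteq> E3" "(e * v) * \<Sum>E3 = e * v"
    using frame_extend_right[OF E2(1) add.hyps(2)] by metis
  have sub: "E1 \<subseteq> E3"
    using E2 E3 by blast
  have "\<Sum>E3 * (u * e) = u * e"
    by (rule frame_mono_left[OF E3(1,2) E2(3)])
  hence "\<Sum>E3 * (u * e * v) = u * e * v" "(u * e * v) * \<Sum>E3 = u * e * v"
    using E3(3) by (metis mult.assoc)+
  hence "\<Sum>E3 * (x + u * e * v) = x + u * e * v" "(x + u * e * v) * \<Sum>E3 = x + u * e * v"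
    using frame_mono_left[OF E3(1) sub E1(3)] frame_mono_right[OF E3(1) sub E1(4)]
    by (simp_all add: distrib_left distrib_right)
  thus ?case
    using E1 E2 E3 by blast
qed

section \<open>Common units, and frames inside a principal right ideal\<close>

lemma frame_common_unit:
  fixes F :: "'a set"
  assumes "finite F" "F \<subseteq> soc_span"
  obtains E where "frame E" "\<And>x. x \<in> F \<Longrightarrow> \<Sum>E * x = x" "\<And>x. x \<in> F \<Longrightarrow> x * \<Sum>E = x"
proof -
  have "\<exists>E. frame E \<and> (\<forall>x\<in>F. \<Sum>E * x = x \<and> x * \<Sum>E = x)"
    using assms
  proof (induction F)
    case (insert x F)
    then obtain E where E: "frame E" "\<forall>x\<in>F. \<Sum>E * x = x \<and> x * \<Sum>E = x"
      by auto
    obtain E' where E': "frame E'" "E \<subseteq> E'" "\<Sum>E' * x = x" "x * \<Sum>E' = x"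
      using frame_extend[of x E] insert.prems E by auto
    thus ?case
      using E(2) frame_mono_left[OF E'(1,2)] frame_mono_right[OF E'(1,2)]
      by (intro exI[of _ E']) auto
  qed (use frame_empty in blast)
  thus ?thesis
    using that by blast
qed

text \<open>The result is a frame of the right ideal \<open>x A\<close>. A first frame
  \<open>D\<close> with \<open>x * \<Sum>D = x\<close> cuts \<open>x\<close> into the finitely many
  pieces \<open>x * d\<close>, which are then absorbed one by one, starting from the empty
  frame.\<close>

lemma frame_of_range:
  fixes x :: 'a
  assumes "x \<in> soc_span"
  obtains E where "frame E" "\<Sum>E * x = x" "\<And>e. e \<in> E \<Longrightarrow> e \<in> range ((*) x)"
proof -
  obtain D where D: "frame D" "x * \<Sum>D = x"
    using frame_common_unit[of "{x}"] assms by auto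
  have "\<exists>E. frame E \<and> E \<subseteq> range ((*) x) \<and> (\<forall>d\<in>D'. \<Sum>E * (x * d) = x * d)" if "finite D'" "D' \<subseteq> D" for D'
    using that
  proof (induction D')
    case (insert d D')
    then obtain E where E: "frame E" "E \<subseteq> range ((*) x)" "\<forall>d\<in>D'. \<Sum>E * (x * d) = x * d"
      by auto
    have "minimal_idempotent d"
      using D insert.prems by (auto simp: frame_def)
    then obtain E' where E': "frame E'" "E \<subseteq> E'" "\<Sum>E' * (x * d) = x * d"
      "\<And>h. h \<in> E' \<Longrightarrow> h \<in> E \<or> (\<exists>b. h = (1 - \<Sum>E) * (x * d) * b)"
      using frame_extend_left[OF E(1)] by metis
    \<comment> \<open>Writing \<open>\<Sum>E = x * c\<close> shows that the new idempotent stays in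
      the ideal: \<open>(1 - x c) x d b = x (1 - c x) d b\<close>.\<close>
    have "\<Sum>E \<in> range ((*) x)"
    proof -
      have "\<forall>e\<in>E. \<exists>b. e = x * b"
        using E by auto
      then obtain b where "\<forall>e\<in>E. e = x * b e"
        by metis
      hence "\<Sum>E = x * (\<Sum>e\<in>E. b e)"
        by (simp add: sum_distrib_left)
      thus ?thesis by simp
    qed
    then obtain c where c: "\<Sum>E = x * c"
      by auto
    have "E' \<subseteq> range ((*) x)"
    proof
      fix h assume "h \<in> E'"
      from E'(4)[OF this] show "h \<in> range ((*) x)"
      proof
        assume "\<exists>b. h = (1 - \<Sum>E) * (x * d) * b"
        then obtain b where "h = (1 - \<Sum>E) * (x * d) * b" ..
        hence "h = x * ((1 - c * x) * d * b)"
          by (simp add: c algebra_simps)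
        thus ?thesis by simp
      qed (use E in auto)
    qed
    thus ?case
      using E' E(3) frame_mono_left[OF E'(1,2)] by (intro exI[of _ E']) auto
  qed (use frame_empty in blast)
  from this[of D] obtain E where E: "frame E" "E \<subseteq> range ((*) x)" "\<forall>d\<in>D. \<Sum>E * (x * d) = x * d"
    using D by (auto simp: frame_def)
  have "\<Sum>E * (x * \<Sum>D) = x * \<Sum>D"
    using E by (simp add: sum_distrib_left)
  thus ?thesis
    using that[of E] E D by auto
qed

text \<open>A nonzero right ideal inside \<open>e A\<close> contains some
  \<open>e * t \<noteq> 0\<close>, and semiprimeness provides a multiple of it that equals
  \<open>e\<close>.\<close>

lemma minimal_right_ideal_range:
  fixes e :: 'a
  assumes e: "minimal_idempotent e"
  shows "minimal_right_ideal (range ((*) e))"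
  unfolding minimal_right_ideal_def
proof (intro conjI allI impI)
  show "right_ideal (range ((*) e))"
    unfolding right_ideal_def
  proof (intro conjI ballI allI)
    show "0 \<in> range ((*) e)"
      using mult_zero_right by (metis rangeI)
    show "x + y \<in> range ((*) e)" if "x \<in> range ((*) e)" "y \<in> range ((*) e)" for x y
      using that by (auto simp flip: distrib_left)
    show "x * a \<in> range ((*) e)" if "x \<in> range ((*) e)" for x a
      using that by (auto simp: mult.assoc)
  qed
  have "e \<in> range ((*) e)"
    using e by (metis minimal_idempotent_def rangeI)
  thus "range ((*) e) \<noteq> {0}"
    using e by (auto simp: minimal_idempotent_def)
  fix S :: "'a set"
  assume S: "right_ideal S \<and> S \<subseteq> range ((*) e)"
  show "S = {0} \<or> S = range ((*) e)"
  proof (cases "S = {0}")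
    case False
    moreover have "0 \<in> S"
      using S by (simp add: right_ideal_def)
    ultimately obtain s where s: "s \<in> S" "s \<noteq> 0"
      by blast
    then obtain t where t: "s = e * t"
      using S by auto
    have "1 * e * t \<noteq> 0"
      using s t by simp
    then obtain b a where ab: "e * t * b * 1 * e = a *\<^sub>C e" "a \<noteq> 0"
      by (rule semiprime_minimal_idempotent[OF e])
    have "s * (b * e * ((1 / a) *\<^sub>C 1)) = (1 / a) *\<^sub>C (e * t * b * 1 * e)"
      by (simp add: t scaleC_simps mult.assoc)
    also have "\<dots> = e"
      using ab by simp
    finally have "e \<in> S"
      using S s unfolding right_ideal_def by metis
    hence "range ((*) e) \<subseteq> S"
      using S by (auto simp: right_ideal_def)
    thus ?thesis using S by blast
  qed simp
qed

text \<open>Brauer's lemma; the division algebra \<open>e A e\<close> consists of scalars by Gelfand and Mazur.\<close>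

lemma minimal_right_ideal_generator:
  fixes R :: "'a set"
  assumes R: "minimal_right_ideal R"
  obtains e where "minimal_idempotent e" "R = range ((*) e)"
proof -
  have ideal: "right_ideal R" and ne: "R \<noteq> {0}"
    and min: "\<And>S. right_ideal S \<Longrightarrow> S \<subseteq> R \<Longrightarrow> S = {0} \<or> S = R"
    using R by (auto simp: minimal_right_ideal_def)
  have R0: "0 \<in> R" and Radd: "\<And>x y. x \<in> R \<Longrightarrow> y \<in> R \<Longrightarrow> x + y \<in> R"
    and Rmult: "\<And>x a. x \<in> R \<Longrightarrow> x * a \<in> R"
    using ideal by (auto simp: right_ideal_def)
  have Rdiff: "x - y \<in> R" if "x \<in> R" "y \<in> R" for x y
    using Radd[OF that(1) Rmult[OF that(2), of "- 1"]] by simp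
  have image_ideal: "right_ideal ((*) a ` R)" for a
    unfolding right_ideal_def
  proof (intro conjI ballI allI)
    show "0 \<in> (*) a ` R"
      using R0 by (force simp: image_iff)
    show "x + y \<in> (*) a ` R" if "x \<in> (*) a ` R" "y \<in> (*) a ` R" for x y
      using that Radd by (auto simp flip: distrib_left)
    show "x * b \<in> (*) a ` R" if "x \<in> (*) a ` R" for x b
      using that Rmult by (auto simp: mult.assoc)
  qed
  have image: "(*) a ` R = R" if "a \<in> R" "r \<in> R" "a * r \<noteq> 0" for a r
  proof -
    have "(*) a ` R \<subseteq> R"
      using that Rmult by auto
    moreover have "a * r \<in> (*) a ` R"
      using that by simp
    ultimately show ?thesis
      using min[OF image_ideal[of a]] that(3) by auto
  qed
  obtain x where x: "x \<in> R" "x \<noteq> 0"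
    using ne R0 by blast
  then obtain c where "x * c * x \<noteq> 0"
    using semiprime by blast
  then obtain a r where ar: "a \<in> R" "r \<in> R" "a * r \<noteq> 0"
    using x Rmult by blast
  have "a \<in> (*) a ` R"
    using image[OF ar] ar by blast
  then obtain e where e: "e \<in> R" "a * e = a"
    by auto
  \<comment> \<open>The annihilator of \<open>a\<close> in \<open>R\<close> is a right ideal that
    misses \<open>r\<close>, so it is zero by minimality. As \<open>a * e = a\<close>, it contains
    \<open>e * e - e\<close>, whence \<open>e\<close> is idempotent.\<close>
  have "right_ideal {z \<in> R. a * z = 0}"
    using R0 Radd Rmult unfolding right_ideal_def by (auto simp: distrib_left simp flip: mult.assoc)
  hence "{z \<in> R. a * z = 0} = {0} \<or> {z \<in> R. a * z = 0} = R"
    by (rule min) simp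
  hence ann: "{z \<in> R. a * z = 0} = {0}"
    using ar by auto
  have "a * (e * e - e) = a * e * e - a * e"
    by (simp add: right_diff_distrib mult.assoc)
  hence "a * (e * e - e) = 0"
    by (simp add: e)
  hence "e * e - e \<in> {z \<in> R. a * z = 0}"
    using e Rmult Rdiff by simp
  hence ee: "e * e = e"
    unfolding ann by simp
  have "e \<noteq> 0"
    using e ar by auto
  have Re: "R = range ((*) e)"
  proof -
    have "(*) e ` R = R"
      using image[of e e] e ee \<open>e \<noteq> 0\<close> by simp
    hence "R \<subseteq> range ((*) e)"
      by blast
    thus ?thesis
      using e(1) Rmult by blast
  qed
  have eR: "e * x = x" if "x \<in> R" for x
    using that ee unfolding Re by (auto simp flip: mult.assoc)
  \<comment> \<open>For \<open>x\<close> in \<open>e A e\<close>, minimality makes left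
    multiplication by \<open>x\<close> surjective on \<open>R\<close>; the factor \<open>e\<close>
    on the right brings the solution back into \<open>e A e\<close>.\<close>
  have right_inverse: "\<exists>y. y \<in> R \<and> y * e = y \<and> x * y = e" if "x \<in> R" "x * e = x" "x \<noteq> 0" for x
  proof -
    have "(*) x ` R = R"
      using image[of x e] that e by simp
    then obtain y where y: "y \<in> R" "x * y = e"
      using e by (metis imageE)
    have "y * e * e = y * e" "x * (y * e) = e"
      using y ee by (simp add: mult.assoc) (simp add: y ee flip: mult.assoc)
    thus ?thesis
      using Rmult[OF y(1), of e] by blast
  qed
  have inverse: "\<exists>y. y \<in> R \<and> y * e = y \<and> x * y = e \<and> y * x = e" if x: "x \<in> R" "x * e = x" "x \<noteq> 0" for x
  proof -
    obtain y where y: "y \<in> R" "y * e = y" "x * y = e"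
      using right_inverse[OF x] by blast
    moreover have "y \<noteq> 0"
      using y \<open>e \<noteq> 0\<close> by auto
    ultimately obtain z where z: "z \<in> R" "z * e = z" "y * z = e"
      using right_inverse by blast
    have "x = x * (y * z)"
      using z x by simp
    also have "\<dots> = z"
      using y eR[OF z(1)] by (simp flip: mult.assoc)
    finally show ?thesis
      using y z by auto
  qed
  interpret norm: algebra_seminorm "norm :: 'a \<Rightarrow> real"
    by unfold_locales (auto simp: norm_triangle_ineq norm_mult_ineq norm_scaleC)
  have "minimal_idempotent e"
    unfolding minimal_idempotent_def
  proof (intro conjI allI)
    fix x
    show "\<exists>\<nu>. e * x * e = \<nu> *\<^sub>C e"
    proof (rule ccontr)
      assume *: "\<nexists>\<nu>. e * x * e = \<nu> *\<^sub>C e"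
      define u where "u \<nu> = \<nu> *\<^sub>C e - e * x * e" for \<nu>
      have "u \<nu> \<in> R" "u \<nu> * e = u \<nu>" "u \<nu> \<noteq> 0" for \<nu>
      proof -
        have "u \<nu> = e * (\<nu> *\<^sub>C 1 - x * e)"
          by (simp add: u_def algebra_simps scaleC_simps)
        thus "u \<nu> \<in> R"
          using Re by simp
        show "u \<nu> * e = u \<nu>"
          by (simp add: u_def algebra_simps scaleC_simps ee)
        show "u \<nu> \<noteq> 0"
          using * unfolding u_def by (metis eq_iff_diff_eq_0)
      qed
      hence "\<forall>\<nu>. \<exists>y. y \<in> R \<and> y * e = y \<and> u \<nu> * y = e \<and> y * u \<nu> = e"
        using inverse by blast
      then obtain y where y: "\<And>\<nu>. y \<nu> \<in> R" "\<And>\<nu>. y \<nu> * e = y \<nu>" "\<And>\<nu>. u \<nu> * y \<nu> = e"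
          "\<And>\<nu>. y \<nu> * u \<nu> = e"
        by metis
      have "norm e = 0"
        using y(2-4) eR[OF y(1)] unfolding u_def
        by (intro norm.corner_spectrum_nonempty[of y e "e * x * e"]) simp_all
      thus False
        using \<open>e \<noteq> 0\<close> by simp
    qed
  qed (use ee \<open>e \<noteq> 0\<close> in auto)
  thus ?thesis
    using that Re by blast
qed

end


section \<open>The trace with respect to a frame\<close>


definition coord :: "'a::complex_banach_algebra \<Rightarrow> 'a \<Rightarrow> complex" where
  "coord e x = (THE a. e * x * e = a *\<^sub>C e)"

lemma coord_unique:
  assumes "minimal_idempotent e" "e * x * e = a *\<^sub>C e"
  shows "coord e x = a"
  unfolding coord_def using assms
  by (intro the_equality) (auto simp: minimal_idempotent_def)

lemma coord_mult:
  assumes "minimal_idempotent e"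
  shows "e * x * e = coord e x *\<^sub>C e"
  using assms coord_unique minimal_idempotentE by metis

lemma coord_add: "minimal_idempotent e \<Longrightarrow> coord e (x + y) = coord e x + coord e y"
  by (rule coord_unique) (simp_all add: distrib_left distrib_right coord_mult scaleC_add_left)

lemma coord_scale: "minimal_idempotent e \<Longrightarrow> coord e (c *\<^sub>C x) = c * coord e x"
  by (rule coord_unique) (simp_all add: scaleC_simps coord_mult)

lemma coord_zero [simp]: "minimal_idempotent e \<Longrightarrow> coord e 0 = 0"
  by (rule coord_unique) simp_all

lemma coord_sum: "minimal_idempotent e \<Longrightarrow> coord e (sum f I) = (\<Sum>i\<in>I. coord e (f i))"
  by (induction I rule: infinite_finite_induct) (simp_all add: coord_add)

text \<open>
  With \<open>u = e x f\<close> and \<open>v = f y e\<close>, both sides are the scalar by which \<open>u v u\<close> differs from \<open>u\<close>.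
\<close>

lemma coord_swap:
  assumes e: "minimal_idempotent e" and f: "minimal_idempotent f"
  shows "coord e (x * f * y) = coord f (y * e * x)"
proof -
  define u v where "u = e * x * f" and "v = f * y * e"
  have ee: "e * e = e" and ff: "f * f = f"
    using e f by (auto simp: minimal_idempotent_def)
  have ee': "e * (e * z) = e * z" and ff': "f * (f * z) = f * z" for z
    by (metis ee ff mult.assoc)+
  have "u * v = e * (x * f * y) * e" "v * u = f * (y * e * x) * f"
    by (simp_all add: u_def v_def mult.assoc ee' ff')
  hence uv: "u * v = coord e (x * f * y) *\<^sub>C e" and vu: "v * u = coord f (y * e * x) *\<^sub>C f"
    using e f by (simp_all add: coord_mult)
  have "e * u = u" "u * f = u"
    by (simp_all add: u_def mult.assoc ee' ff)
  hence "coord e (x * f * y) *\<^sub>C u = (u * v) * u" "u * (v * u) = coord f (y * e * x) *\<^sub>C u"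
    unfolding uv vu by (simp_all add: scaleC_simps)
  hence "coord e (x * f * y) *\<^sub>C u = coord f (y * e * x) *\<^sub>C u"
    by (simp add: mult.assoc)
  moreover have "coord e (x * f * y) = 0" "coord f (y * e * x) = 0" if "u = 0"
    using uv vu that e f by (auto simp: minimal_idempotent_def)
  ultimately show ?thesis
    by (cases "u = 0") auto
qed

text \<open>For a general \<open>x\<close> this is the trace of the compression of \<open>x\<close>
  to the corner of \<open>\<Sum>E\<close> and depends on \<open>E\<close>; this is why the later
  statements ask that \<open>\<Sum>E\<close> absorb an element.\<close>

definition frame_trace :: "'a::complex_banach_algebra set \<Rightarrow> 'a \<Rightarrow> complex" where
  "frame_trace E x = (\<Sum>e\<in>E. coord e x)"

lemma frame_trace_add: "frame E \<Longrightarrow> frame_trace E (x + y) = frame_trace E x + frame_trace E y"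
  by (simp add: frame_trace_def frame_def coord_add sum.distrib)

lemma frame_trace_scale: "frame E \<Longrightarrow> frame_trace E (c *\<^sub>C x) = c * frame_trace E x"
  by (simp add: frame_trace_def frame_def coord_scale sum_distrib_left)

lemma frame_trace_zero [simp]: "frame E \<Longrightarrow> frame_trace E 0 = 0"
  by (simp add: frame_trace_def frame_def)

lemma frame_trace_diff: "frame E \<Longrightarrow> frame_trace E (x - y) = frame_trace E x - frame_trace E y"
  using frame_trace_add[of E "x - y" y] by simp

lemma frame_trace_sum: "frame E \<Longrightarrow> frame_trace E (sum f I) = (\<Sum>i\<in>I. frame_trace E (f i))"
  by (induction I rule: infinite_finite_induct) (simp_all add: frame_trace_add)

text \<open>The matrix computation: insert \<open>\<Sum>E\<close> before \<open>b\<close>, swap each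
  pair of entries by \<open>coord_swap\<close>, and exchange the two sums. The element
  \<open>a\<close> ranges over the whole algebra, as the index requires for the commutator of
  \<open>f\<close> with \<open>a\<^sub>0\<close>.\<close>

lemma frame_trace_commute:
  assumes E: "frame E" and b: "\<Sum>E * b = b" "b * \<Sum>E = b"
  shows "frame_trace E (a * b) = frame_trace E (b * a)"
proof -
  have min: "minimal_idempotent e" if "e \<in> E" for e
    using E that by (simp add: frame_def)
  have "frame_trace E (a * (\<Sum>E * b)) = (\<Sum>e\<in>E. coord e (\<Sum>f\<in>E. a * f * b))"
    by (simp add: frame_trace_def sum_distrib_left sum_distrib_right mult.assoc)
  also have "\<dots> = (\<Sum>e\<in>E. \<Sum>f\<in>E. coord f (b * e * a))"
    by (intro sum.cong refl) (simp add: min coord_sum coord_swap)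
  also have "\<dots> = (\<Sum>f\<in>E. coord f (\<Sum>e\<in>E. b * e * a))"
    by (subst sum.swap) (intro sum.cong refl, simp add: min coord_sum)
  also have "\<dots> = frame_trace E ((b * \<Sum>E) * a)"
    by (simp add: frame_trace_def sum_distrib_left sum_distrib_right)
  finally show ?thesis
    by (simp add: b)
qed

text \<open>By \<open>coord_swap\<close> the entry of \<open>q\<close> at \<open>e\<close> equals
  the entry of \<open>e\<close> at \<open>q\<close>. These add up to the entry of
  \<open>\<Sum>E\<close> at \<open>q\<close>, which is 1 because
  \<open>q * \<Sum>E * q = q\<close>.\<close>

lemma frame_trace_minimal_idempotent:
  assumes E: "frame E" and q: "minimal_idempotent q" "\<Sum>E * q = q"
  shows "frame_trace E q = 1"
proof -
  have "frame_trace E (1 * q * 1) = (\<Sum>e\<in>E. coord q (1 * e * 1))"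
    unfolding frame_trace_def using E q
    by (intro sum.cong refl coord_swap) (auto simp: frame_def)
  also have "\<dots> = coord q (\<Sum>E)"
    using q by (simp add: coord_sum)
  also have "\<dots> = 1"
    using q by (intro coord_unique) (auto simp: mult.assoc minimal_idempotent_def)
  finally show ?thesis by simp
qed

lemma frame_trace_frame:
  assumes E: "frame E" and D: "frame D" "\<Sum>E * \<Sum>D = \<Sum>D"
  shows "frame_trace E (\<Sum>D) = of_nat (card D)"
proof -
  have "\<Sum>E * d = d" if "d \<in> D" for d
    using D frame_mult_sum[OF D(1) that] by (metis mult.assoc)
  hence "(\<Sum>d\<in>D. frame_trace E d) = (\<Sum>d\<in>D. 1)"
    using D E by (intro sum.cong refl frame_trace_minimal_idempotent) (auto simp: frame_def)
  thus ?thesis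
    using E by (simp add: frame_trace_sum)
qed

section \<open>Sums of right ideals\<close>

lemma ideal_sum_add:
  fixes \<R> :: "'a::complex_banach_algebra set set"
  assumes \<R>: "\<And>R. R \<in> \<R> \<Longrightarrow> right_ideal R" and "x \<in> ideal_sum \<R>" "y \<in> ideal_sum \<R>"
  shows "x + y \<in> ideal_sum \<R>"
proof -
  obtain F f where F: "finite F" "F \<subseteq> \<R>" "\<forall>R\<in>F. f R \<in> R" "x = (\<Sum>R\<in>F. f R)"
    using assms unfolding ideal_sum_def by blast
  obtain G g where G: "finite G" "G \<subseteq> \<R>" "\<forall>R\<in>G. g R \<in> R" "y = (\<Sum>R\<in>G. g R)"
    using assms unfolding ideal_sum_def by blast
  \<comment> \<open>A sum of ideals takes one summand from each ideal, so the two families are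
    extended by 0 and merged over the union of their index sets.\<close>
  define h where "h R = (if R \<in> F then f R else 0) + (if R \<in> G then g R else 0)" for R
  have "(\<Sum>R\<in>F. f R) = (\<Sum>R\<in>F \<union> G. if R \<in> F then f R else 0)"
    using F G by (intro sum.mono_neutral_cong_left) auto
  moreover have "(\<Sum>R\<in>G. g R) = (\<Sum>R\<in>F \<union> G. if R \<in> G then g R else 0)"
    using F G by (intro sum.mono_neutral_cong_left) auto
  ultimately have "x + y = (\<Sum>R\<in>F \<union> G. h R)"
    using F G by (simp add: h_def sum.distrib)
  moreover have "\<forall>R\<in>F \<union> G. h R \<in> R"
    using F G \<R> by (auto simp: h_def right_ideal_def)
  moreover have "finite (F \<union> G)" "F \<union> G \<subseteq> \<R>"
    using F G by auto
  ultimately show ?thesis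
    unfolding ideal_sum_def by blast
qed

lemma ideal_sum_member:
  assumes "R \<in> \<R>" "x \<in> R"
  shows "x \<in> ideal_sum \<R>"
  unfolding ideal_sum_def using assms
  by (intro CollectI exI[of _ "{R}"] exI[of _ "\<lambda>_. x"]) auto

lemma zero_ideal_sum: "0 \<in> ideal_sum \<R>"
  unfolding ideal_sum_def by (intro CollectI exI[of _ "{}"]) auto

lemma soc_add: "x \<in> soc \<Longrightarrow> y \<in> soc \<Longrightarrow> x + y \<in> soc"
  unfolding soc_def by (rule ideal_sum_add) (auto simp: minimal_right_ideal_def)

context
  assumes semisimple: "jacobson_radical = ({0} :: 'a::complex_banach_algebra set)"
begin

text \<open>Brauer's lemma gives one inclusion. For the other, \<open>u * e * v\<close> is not
  visibly in a minimal right ideal; a frame that fixes \<open>u * e\<close> splits it into the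
  pieces \<open>h * (u * e * v)\<close>, each in the minimal right ideal \<open>h A\<close>.\<close>

lemma soc_eq_soc_span: "soc = (soc_span :: 'a set)"
proof (intro equalityI subsetI)
  fix x :: 'a assume "x \<in> soc"
  then obtain F f where F: "\<forall>R\<in>F. minimal_right_ideal R \<and> f R \<in> R" "x = (\<Sum>R\<in>F. f R)"
    unfolding soc_def ideal_sum_def by blast
  have "f R \<in> soc_span" if "R \<in> F" for R
  proof -
    have "minimal_right_ideal R"
      using F that by simp
    then obtain e where e: "minimal_idempotent e" "R = range ((*) e)"
      by (rule minimal_right_ideal_generator[OF semisimple])
    have "f R \<in> range ((*) e)"
      using F(1) that unfolding e(2)[symmetric] by simp
    then obtain y where "f R = e * y"
      by blast
    thus ?thesis
      by (simp add: soc_span_mult_right minimal_idempotent_soc_span e)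
  qed
  thus "x \<in> soc_span"
    by (simp add: F soc_span_sum)
next
  fix x :: 'a assume "x \<in> soc_span"
  thus "x \<in> soc"
  proof (induction x rule: soc_span.induct)
    case zero
    show ?case by (simp add: soc_def zero_ideal_sum)
  next
    case (add x e u v)
    obtain E where E: "frame E" "\<Sum>E * (u * e) = u * e"
      using frame_extend_left[OF semisimple frame_empty add.hyps(2)] by metis
    have "u * e * v = \<Sum>E * (u * e * v)"
      using E by (simp flip: mult.assoc)
    also have "\<dots> = (\<Sum>h\<in>E. h * (u * e * v))"
      by (simp add: sum_distrib_right)
    finally have *: "u * e * v = (\<Sum>h\<in>E. h * (u * e * v))" .
    have "(\<Sum>h\<in>E'. h * (u * e * v)) \<in> soc" if "E' \<subseteq> E" "finite E'" for E'
      using that(2,1)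
    proof (induction E')
      case empty
      show ?case by (simp add: soc_def zero_ideal_sum)
    next
      case (insert h E')
      have "minimal_right_ideal (range ((*) h))"
        using insert.prems E by (intro minimal_right_ideal_range semisimple) (auto simp: frame_def)
      hence "h * (u * e * v) \<in> soc"
        unfolding soc_def by (intro ideal_sum_member[of "range ((*) h)"]) auto
      moreover have "(\<Sum>h\<in>E'. h * (u * e * v)) \<in> soc"
        using insert by blast
      ultimately show ?case
        using insert.hyps by (simp add: soc_add)
    qed
    from this[of E] * have "u * e * v \<in> soc"
      using E by (simp add: frame_def)
    with add.IH show ?case
      by (rule soc_add)
  qed
qed

text \<open>Induction on the exponent. With \<open>h = x * b\<close> and \<open>h * x = x\<close>,
  the trace of \<open>x = h * x\<close> equals that of \<open>x * h\<close>, whose power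
  \<open>(x h)^n = x^n h = x^(n+1) b\<close> already vanishes.\<close>

lemma frame_trace_nilpotent:
  fixes x :: 'a
  assumes E: "frame E" and x: "x \<in> soc_span" "\<Sum>E * x = x" "x * \<Sum>E = x" and nil: "x ^ n = 0"
  shows "frame_trace E x = 0"
  using x nil
proof (induction n arbitrary: x)
  case 0
  hence "x = 0"
    by (metis mult_1 mult_zero_left power_0)
  thus ?case using E by simp
next
  case (Suc n)
  obtain D where D: "frame D" "\<Sum>D * x = x" "\<And>d. d \<in> D \<Longrightarrow> d \<in> range ((*) x)"
    using frame_of_range[OF semisimple Suc.prems(1)] by metis
  have "\<forall>d\<in>D. \<exists>c. d = x * c"
    using D(3) by auto
  then obtain c where c: "\<And>d. d \<in> D \<Longrightarrow> d = x * c d"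
    by metis
  \<comment> \<open>The trailing \<open>\<Sum>E\<close> makes \<open>x * h\<close> absorbed by the
    frame from the right, as the induction hypothesis demands.\<close>
  define b where "b = (\<Sum>d\<in>D. c d) * \<Sum>E"
  define h where "h = x * b"
  have "\<Sum>D = x * (\<Sum>d\<in>D. c d)"
    using c by (simp add: sum_distrib_left)
  hence h: "h = \<Sum>D * \<Sum>E"
    by (simp add: h_def b_def mult.assoc)
  have hx: "h * x = x"
    by (simp add: h mult.assoc Suc.prems D)
  have "frame_trace E x = frame_trace E (x * h)"
    using frame_trace_commute[OF E Suc.prems(2,3), of h] by (simp add: hx)
  also have "\<dots> = 0"
  proof (cases n)
    case 0
    thus ?thesis using Suc.prems E by simp
  next
    case (Suc m)
    have pow: "(x * h) ^ Suc k = x ^ Suc k * h" for k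
    proof (induction k)
      case (Suc k)
      have "(x * h) ^ Suc (Suc k) = (x * h) * (x ^ Suc k * h)"
        using Suc.IH by simp
      also have "\<dots> = x * (h * x) * x ^ k * h"
        by (simp add: mult.assoc)
      finally show ?case
        by (simp add: hx mult.assoc)
    qed simp
    show ?thesis
    proof (rule Suc.IH)
      show "x * h \<in> soc_span"
        by (intro soc_span_mult_right Suc.prems)
      show "\<Sum>E * (x * h) = x * h"
        using Suc.prems by (simp flip: mult.assoc)
      show "x * h * \<Sum>E = x * h"
        by (simp add: h mult.assoc frame_sum_idem[OF E])
      have "x ^ n * h = x ^ Suc n * b"
        by (simp add: h_def power_Suc2 mult.assoc del: power_Suc)
      hence "x ^ n * h = 0"
        by (simp only: Suc.prems(4) mult_zero_left)
      thus "(x * h) ^ n = 0"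
        by (simp only: \<open>n = Suc m\<close> pow)
    qed
  qed
  finally show ?case .
qed

text \<open>The rank counts ideals, the frame counts idempotents. The ideals \<open>d A\<close> are
  distinct and sum to \<open>p A\<close>. Conversely any \<open>n\<close> minimal right ideals with
  sum \<open>p A\<close> yield a frame \<open>G\<close> of \<open>p A\<close> with at most
  \<open>n\<close> members, and both cardinalities equal the trace of \<open>p\<close>.\<close>

lemma frame_of_idempotent:
  fixes p :: 'a
  assumes p: "p * p = p" "p \<in> soc_span"
  obtains D where "frame D" "\<Sum>D * p = p" "p * \<Sum>D = \<Sum>D" "alg_rank p = card D"
proof -
  obtain D where D: "frame D" "\<Sum>D * p = p" "\<And>d. d \<in> D \<Longrightarrow> d \<in> range ((*) p)"
    using frame_of_range[OF semisimple p(2)] by metis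
  have pd: "p * d = d" if "d \<in> D" for d
    using D(3)[OF that] p by (auto simp flip: mult.assoc)
  hence pD: "p * \<Sum>D = \<Sum>D"
    by (simp add: sum_distrib_left)
  have "alg_rank p = card D"
    unfolding alg_rank_def
  proof (rule Least_equality)
    have D0: "d \<noteq> 0" if "d \<in> D" for d
      using D that by (auto simp: frame_def minimal_idempotent_def)
    have inj: "inj_on (\<lambda>d. range ((*) d)) D"
    proof (rule inj_onI)
      fix d d' assume d: "d \<in> D" "d' \<in> D" "range ((*) d) = range ((*) d')"
      have "d * d = d"
        using D d by (auto simp: frame_def minimal_idempotent_def)
      hence "d \<in> range ((*) d')"
        using d by (metis rangeI)
      hence "d' * d = d"
        using D d by (auto simp: frame_def minimal_idempotent_def simp flip: mult.assoc)
      moreover have "d' * d = 0" if "d \<noteq> d'"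
        using D(1) d that unfolding frame_def by metis
      ultimately show "d = d'"
        using D0[OF d(1)] by metis
    qed
    let ?R = "(\<lambda>d. range ((*) d)) ` D"
    have "ideal_sum ?R = range ((*) p)"
    proof (intro equalityI subsetI)
      fix x assume "x \<in> ideal_sum ?R"
      then obtain F f where F: "F \<subseteq> ?R" "\<forall>R\<in>F. f R \<in> R" "x = (\<Sum>R\<in>F. f R)"
        unfolding ideal_sum_def by blast
      have "p * f R = f R" if R: "R \<in> F" for R
      proof -
        obtain d where d: "d \<in> D" "R = range ((*) d)"
          using F R by blast
        then obtain y where "f R = d * y"
          using F R by auto
        thus ?thesis
          using pd[OF d(1)] by (simp flip: mult.assoc)
      qed
      hence "p * x = x"
        by (simp add: F sum_distrib_left)
      thus "x \<in> range ((*) p)"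
        by (metis rangeI)
    next
      fix x assume "x \<in> range ((*) p)"
      then obtain y where "x = p * y"
        by auto
      hence "x = \<Sum>D * x"
        using D by (simp flip: mult.assoc)
      hence x: "x = (\<Sum>d\<in>D. d * x)"
        by (simp add: sum_distrib_right)
      have "(\<Sum>d\<in>D'. d * x) \<in> ideal_sum ?R" if "finite D'" "D' \<subseteq> D" for D'
        using that
      proof (induction D')
        case (insert d D')
        have "d * x \<in> ideal_sum ?R"
          using insert.prems by (intro ideal_sum_member[of "range ((*) d)"]) auto
        moreover have "right_ideal R" if "R \<in> ?R" for R
          using that D minimal_right_ideal_range[OF semisimple]
          by (auto simp: minimal_right_ideal_def frame_def)
        ultimately show ?case
          using insert by (auto intro!: ideal_sum_add)
      qed (simp add: zero_ideal_sum)
      from this[of D] x show "x \<in> ideal_sum ?R"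
        using D by (simp add: frame_def)
    qed
    thus "\<exists>\<R>. finite \<R> \<and> card \<R> = card D \<and> (\<forall>R\<in>\<R>. minimal_right_ideal R) \<and>
        ideal_sum \<R> = range (\<lambda>x. p * x)"
      using D minimal_right_ideal_range[OF semisimple] inj
      by (intro exI[of _ ?R]) (auto simp: frame_def card_image)
  next
    fix n
    assume "\<exists>\<R>. finite \<R> \<and> card \<R> = n \<and> (\<forall>R\<in>\<R>. minimal_right_ideal R) \<and>
        ideal_sum \<R> = range (\<lambda>x. p * x)"
    then obtain \<R> where \<R>: "finite \<R>" "card \<R> = n" "\<And>R. R \<in> \<R> \<Longrightarrow> minimal_right_ideal R"
        "ideal_sum \<R> = range (\<lambda>x. p * x)"
      by blast
    have p_left: "p * r = r" if "R \<in> \<R>" "r \<in> R" for R r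
      using ideal_sum_member[OF that] p \<R> by (auto simp flip: mult.assoc)
    \<comment> \<open>Each ideal costs at most one new idempotent, which is where the cardinality
      clause of \<open>frame_extend_left\<close> enters.\<close>
    have "\<exists>G. frame G \<and> card G \<le> card \<R>' \<and> p * \<Sum>G = \<Sum>G \<and> (\<forall>R\<in>\<R>'. \<forall>r\<in>R. \<Sum>G * r = r)"
      if "finite \<R>'" "\<R>' \<subseteq> \<R>" for \<R>'
      using that
    proof (induction \<R>')
      case empty
      show ?case by (intro exI[of _ "{}"]) simp
    next
      case (insert R \<R>')
      then obtain G where G: "frame G" "card G \<le> card \<R>'" "p * \<Sum>G = \<Sum>G"
          "\<forall>R\<in>\<R>'. \<forall>r\<in>R. \<Sum>G * r = r"
        by auto
      obtain e where e: "minimal_idempotent e" "R = range ((*) e)"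
        using minimal_right_ideal_generator[OF semisimple, of R] insert.prems \<R> by blast
      obtain G' where G': "frame G'" "G \<subseteq> G'" "\<Sum>G' * (1 * e) = 1 * e" "card G' \<le> Suc (card G)"
          "\<And>h. h \<in> G' \<Longrightarrow> h \<in> G \<or> (\<exists>b. h = (1 - \<Sum>G) * (1 * e) * b)"
        using frame_extend_left[OF semisimple G(1) e(1), of 1] by metis
      have pe: "p * e = e"
        using p_left[of R e] insert.prems e by (metis insert_subset minimal_idempotent_def rangeI)
      have "p * h = h" if "h \<in> G'" for h
        using G'(5)[OF that]
      proof
        assume "h \<in> G"
        hence "h = \<Sum>G * h"
          using G by (simp add: frame_mult_sum)
        thus ?thesis
          using G(3) by (metis mult.assoc)
      next
        assume "\<exists>b. h = (1 - \<Sum>G) * (1 * e) * b"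
        then obtain b where b: "h = (1 - \<Sum>G) * (1 * e) * b" ..
        have "p * ((1 - \<Sum>G) * (1 * e)) = (1 - \<Sum>G) * (1 * e)"
          using G(3) pe by (simp add: algebra_simps flip: mult.assoc)
        thus ?thesis
          unfolding b by (simp flip: mult.assoc)
      qed
      hence "p * \<Sum>G' = \<Sum>G'"
        by (simp add: sum_distrib_left)
      moreover have "\<Sum>G' * r = r" if "r \<in> R" for r
        using that G'(3) unfolding e(2) by (auto simp flip: mult.assoc)
      moreover have "\<Sum>G' * r = r" if "R' \<in> \<R>'" "r \<in> R'" for r R'
        using that G(4) frame_mono_left[OF G'(1,2)] by blast
      moreover have "card G' \<le> card (insert R \<R>')"
        using G'(4) G(2) insert.hyps by simp
      ultimately show ?case
        using G'(1) by blast
    qed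
    from this[of \<R>] obtain G where G: "frame G" "card G \<le> n" "p * \<Sum>G = \<Sum>G"
        "\<forall>R\<in>\<R>. \<forall>r\<in>R. \<Sum>G * r = r"
      using \<R> by auto
    have "p \<in> ideal_sum \<R>"
      unfolding \<R> using p by (metis rangeI)
    then obtain F f where F: "F \<subseteq> \<R>" "\<forall>R\<in>F. f R \<in> R" "p = (\<Sum>R\<in>F. f R)"
      unfolding ideal_sum_def by blast
    have Gp: "\<Sum>G * p = p"
      using F G by (subst (1 2) F(3)) (auto simp: sum_distrib_left intro!: sum.cong)
    obtain E where E: "frame E" "\<Sum>E * p = p" "p * \<Sum>E = p"
      using frame_common_unit[OF semisimple, of "{p}"] p by auto
    have EG: "\<Sum>E * \<Sum>G = \<Sum>G" "\<Sum>E * \<Sum>D = \<Sum>D"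
      using E(2) G(3) pD by (metis mult.assoc)+
    have "of_nat (card D) = frame_trace E (p * \<Sum>D)"
      by (simp add: pD frame_trace_frame[OF E(1) D(1) EG(2)])
    also have "\<dots> = frame_trace E (\<Sum>D * p)"
      using frame_trace_commute[OF E] by simp
    also have "\<dots> = frame_trace E (\<Sum>G * p)"
      by (simp add: Gp D)
    also have "\<dots> = frame_trace E (p * \<Sum>G)"
      using frame_trace_commute[OF E] by simp
    also have "\<dots> = of_nat (card G)"
      by (simp add: G frame_trace_frame[OF E(1) G(1) EG(1)])
    finally show "card D \<le> n"
      using G(2) by simp
  qed
  with D pD that show ?thesis by blast
qed

text \<open>The bridge from ranks to linear algebra: identities between ranks follow from linearity
  of the trace, since natural numbers embed into the complex numbers.\<close>

lemma frame_trace_idempotent: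
  fixes p :: 'a
  assumes E: "frame E" and p: "p * p = p" "p \<in> soc_span" "\<Sum>E * p = p" "p * \<Sum>E = p"
  shows "frame_trace E p = of_nat (alg_rank p)"
proof -
  obtain D where D: "frame D" "\<Sum>D * p = p" "p * \<Sum>D = \<Sum>D" "alg_rank p = card D"
    using frame_of_idempotent[OF p(1,2)] by metis
  have "\<Sum>E * \<Sum>D = \<Sum>D"
    using p(3) D(3) by (metis mult.assoc)
  hence "of_nat (card D) = frame_trace E (p * \<Sum>D)"
    by (simp add: D(3) frame_trace_frame[OF E(1) D(1)])
  also have "\<dots> = frame_trace E (\<Sum>D * p)"
    using frame_trace_commute[OF E p(3,4)] by simp
  finally show ?thesis
    by (simp add: D)
qed

lemma alg_rank_eq_0D:
  fixes p :: 'a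
  assumes "p * p = p" "p \<in> soc_span" "alg_rank p = 0"
  shows "p = 0"
proof -
  obtain D where "frame D" "\<Sum>D * p = p" "alg_rank p = card D"
    using frame_of_idempotent[OF assms(1,2)] by metis
  thus ?thesis
    using assms(3) by (simp add: frame_def)
qed

end


section \<open>Drazin inverses\<close>

text \<open>The candidate is \<open>b = a^k x^(k+1)\<close>, which also equals
  \<open>y^(k+1) a^k\<close>. From the two forms, \<open>a b = a^k x^k\<close> and
  \<open>b a = y^k a^k\<close>, and both are equal to \<open>y^k a^(2k) x^k\<close>.\<close>

lemma strongly_pi_regular_drazin:
  fixes a :: "'r::monoid_mult"
  assumes x: "a ^ k = a ^ Suc k * x" and y: "a ^ k = y * a ^ Suc k"
  obtains b where "b * a * b = b" "a * b = b * a" "a ^ k * b * a = a ^ k"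
proof -
  have R: "a ^ (j + k) * x ^ j = a ^ k" for j
  proof (induction j)
    case (Suc j)
    have "a ^ (Suc j + k) * x ^ Suc j = a ^ j * (a ^ Suc k * x) * x ^ j"
      using power_add[of a j "Suc k"] by (simp add: mult.assoc)
    also have "\<dots> = a ^ (j + k) * x ^ j"
      by (simp only: x[symmetric] power_add)
    finally show ?case
      by (simp only: Suc)
  qed simp
  have L: "y ^ j * a ^ (k + j) = a ^ k" for j
  proof (induction j)
    case (Suc j)
    have "y ^ Suc j * a ^ (k + Suc j) = y ^ j * (y * a ^ Suc k) * a ^ j"
      using power_add[of a "Suc k" j] by (simp add: mult.assoc power_Suc2 del: power_Suc)
    also have "\<dots> = y ^ j * a ^ (k + j)"
      by (simp only: y[symmetric] power_add mult.assoc)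
    finally show ?case
      by (simp only: Suc)
  qed simp
  define b where "b = a ^ k * x ^ Suc k"
  have "b = y ^ Suc k * a ^ (k + Suc k) * x ^ Suc k"
    unfolding b_def L ..
  also have "\<dots> = y ^ Suc k * (a ^ (Suc k + k) * x ^ Suc k)"
    by (simp only: mult.assoc add.commute)
  finally have b: "b = y ^ Suc k * a ^ k"
    unfolding R .
  have "a * b = (a ^ Suc k * x) * x ^ k"
    by (simp add: b_def mult.assoc)
  hence ab: "a * b = a ^ k * x ^ k"
    by (simp only: x[symmetric])
  have "b * a = y ^ k * (y * a ^ Suc k)"
    by (simp add: b mult.assoc power_Suc2 del: power_Suc)
  hence ba: "b * a = y ^ k * a ^ k"
    by (simp only: y[symmetric])
  have "a ^ k * x ^ k = y ^ k * a ^ (k + k) * x ^ k"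
    unfolding L ..
  hence "a * b = b * a"
    unfolding ab ba using R[of k] by (simp add: mult.assoc)
  moreover have "b * a * b = b"
  proof -
    have "b * (a * b) = b * (a ^ k * x ^ k)"
      by (simp only: ab)
    also have "\<dots> = y ^ Suc k * (a ^ (k + k) * x ^ k)"
      by (simp only: b mult.assoc power_add)
    finally have "b * (a * b) = y ^ Suc k * (a ^ (k + k) * x ^ k)" .
    thus ?thesis
      unfolding R by (simp add: b mult.assoc)
  qed
  moreover have "a ^ k * b * a = a ^ k"
  proof -
    have "a ^ k * (a * b) = a ^ (k + k) * x ^ k"
      unfolding ab by (simp only: mult.assoc power_add)
    thus ?thesis
      using R \<open>a * b = b * a\<close> by (simp add: mult.assoc)
  qed
  ultimately show ?thesis
    using that by blast
qed

text \<open>A nilpotent element with a left inverse forces the unit to vanish: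
  \<open>u = p * u = b * u * u\<close> can be iterated in \<open>p = b * u\<close>.\<close>

lemma nilpotent_left_invertible:
  fixes p :: "'r::{monoid_mult, mult_zero}"
  assumes "p = b * u" "p * u = u" "u ^ m = 0"
  shows "p = 0"
proof -
  have "p = b ^ Suc j * u ^ Suc j" for j
  proof (induction j)
    case (Suc j)
    have "b ^ Suc (Suc j) * u ^ Suc (Suc j) = b ^ Suc j * ((b * u) * u) * u ^ j"
      by (simp add: mult.assoc power_Suc2[of b] del: power_Suc) (simp add: mult.assoc)
    also have "\<dots> = b ^ Suc j * u ^ Suc j"
      using assms by (simp add: mult.assoc)
    finally show ?case
      using Suc by simp
  qed (use assms in simp)
  from this[of m] show ?thesis
    using assms(3) by (simp add: power_Suc2 del: power_Suc)
qed

context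
  assumes semisimple: "jacobson_radical = ({0} :: 'a::complex_banach_algebra set)"
begin

lemma idempotent_frame_trace_zero:
  fixes p :: 'a
  assumes E: "frame E" and p: "p * p = p" "p \<in> soc_span" "\<Sum>E * p = p" "p * \<Sum>E = p"
    and tr: "frame_trace E p = 0"
  shows "p = 0"
  using frame_trace_idempotent[OF semisimple E p] tr alg_rank_eq_0D[OF semisimple p(1,2)] by simp

text \<open>The number \<open>j\<close> is the length of a frame of \<open>s^k A\<close>. Choose
  \<open>k\<close> with \<open>j\<close> minimal and compare with \<open>2k\<close>: the ideal of
  \<open>s^(2k)\<close> lies in that of \<open>s^k\<close> and has no smaller rank, so the two
  coincide and \<open>s^k\<close> is a right multiple of its square.\<close>

lemma soc_power_square_right:
  fixes s :: 'a
  assumes s: "s \<in> soc_span"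
  obtains k z where "k \<ge> 1" "s ^ k = s ^ k * s ^ k * z"
proof -
  define P where "P j k D \<longleftrightarrow> k \<ge> 1 \<and> card D = j \<and> frame D \<and> \<Sum>D * s ^ k = s ^ k \<and>
    (\<exists>z. \<Sum>D = s ^ k * z)" for j k D
  have ex: "\<exists>j D. P j k D" if k: "k \<ge> 1" for k
  proof -
    have "s ^ k = s * s ^ (k - 1)"
      using k by (simp flip: power_Suc)
    hence "s ^ k \<in> soc_span"
      using s by (simp add: soc_span_mult_right)
    then obtain D where D: "frame D" "\<Sum>D * s ^ k = s ^ k" "\<And>d. d \<in> D \<Longrightarrow> d \<in> range ((*) (s ^ k))"
      by (rule frame_of_range[OF semisimple]) blast
    have "\<forall>d\<in>D. \<exists>z. d = s ^ k * z"
      using D(3) by auto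
    then obtain z where "\<forall>d\<in>D. d = s ^ k * z d"
      by metis
    hence "\<Sum>D = s ^ k * (\<Sum>d\<in>D. z d)"
      by (simp add: sum_distrib_left)
    with D k show ?thesis
      unfolding P_def by blast
  qed
  define j where "j = (LEAST j. \<exists>k D. P j k D)"
  have "\<exists>j k D. P j k D"
    using ex[of 1] by blast
  hence "\<exists>k D. P j k D"
    unfolding j_def by (rule LeastI_ex)
  then obtain k D where D: "P j k D"
    by blast
  have min: "j \<le> j'" if "P j' k' D'" for j' k' D'
    unfolding j_def by (rule Least_le) (use that in blast)
  have k: "k \<ge> 1"
    using D by (simp add: P_def)
  then obtain j' D' where D': "P j' (k + k) D'"
    using ex[of "k + k"] by auto
  define G G' t where "G = \<Sum>D" and "G' = \<Sum>D'" and "t = s ^ k"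
  have G: "frame D" "G * t = t" "G * G = G"
    using D by (auto simp: P_def G_def t_def frame_sum_idem)
  obtain z where z: "G' = t * t * z"
    using D' by (auto simp: P_def G'_def t_def power_add)
  have G': "frame D'" "G' * G' = G'"
    using D' by (auto simp: P_def G'_def frame_sum_idem)
  have GG': "G * G' = G'"
    by (simp add: z G flip: mult.assoc)
  obtain E where E: "frame E" "\<And>x. x \<in> {G, G'} \<Longrightarrow> \<Sum>E * x = x" "\<And>x. x \<in> {G, G'} \<Longrightarrow> x * \<Sum>E = x"
    by (rule frame_common_unit[OF semisimple, of "{G, G'}"])
      (use frame_sum_soc_span G(1) G'(1) in \<open>auto simp: G_def G'_def\<close>)
  have E': "\<Sum>E * G = G" "G * \<Sum>E = G" "\<Sum>E * G' = G'" "G' * \<Sum>E = G'"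
    using E by auto
  \<comment> \<open>Here \<open>G * G' = G'\<close>, but \<open>G'\<close> need not be absorbed by
    \<open>G\<close> from the right. The product \<open>G' * G\<close> is an idempotent below
    \<open>G\<close> with the trace of \<open>G'\<close>, so the rank of \<open>q\<close> is the
    difference of the two frame lengths.\<close>
  define q where "q = G - G' * G"
  have hh: "G' * G * (G' * G) = G' * G" "G * (G' * G) = G' * G" "G' * G * G = G' * G"
    using GG' G' G by (metis mult.assoc)+
  have q: "q * q = q" "q \<in> soc_span" "\<Sum>E * q = q" "q * \<Sum>E = q"
  proof -
    show "q * q = q"
      unfolding q_def by (simp only: left_diff_distrib right_diff_distrib hh G) simp
    show "q \<in> soc_span"
      unfolding q_def using G(1) unfolding G_def
      by (intro soc_span_diff soc_span_mult_left frame_sum_soc_span)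
    show "\<Sum>E * q = q" "q * \<Sum>E = q"
      unfolding q_def using E' by (simp_all add: left_diff_distrib right_diff_distrib mult.assoc)
        (simp flip: mult.assoc)
  qed
  have "frame_trace E (G' * G) = frame_trace E (G * G')"
    by (rule frame_trace_commute[OF E(1) E'(1,2)])
  hence "frame_trace E q = frame_trace E G - frame_trace E G'"
    by (simp add: q_def GG' frame_trace_diff E)
  also have "\<dots> = of_nat j - of_nat j'"
    using frame_trace_frame[OF E(1) G(1)] frame_trace_frame[OF E(1) G'(1)] D D' E'
    by (simp add: P_def G_def G'_def)
  finally have "of_nat (alg_rank q) + of_nat j' = (of_nat j :: complex)"
    using frame_trace_idempotent[OF semisimple E(1) q] by simp
  hence "alg_rank q + j' = j"
    by (metis of_nat_add of_nat_eq_iff)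
  hence "alg_rank q = 0"
    using min[OF D'] by simp
  hence "q = 0"
    by (rule alg_rank_eq_0D[OF semisimple q(1,2)])
  hence "t = G' * t"
    using G by (metis eq_iff_diff_eq_0 mult.assoc q_def)
  hence "t = t * t * (z * t)"
    by (simp add: z mult.assoc)
  thus ?thesis
    using that[of k] k by (simp add: t_def mult.assoc)
qed

text \<open>The hypothesis makes \<open>t * G\<close> right invertible in the corner of
  \<open>G\<close>, the idempotent of \<open>t A\<close>, with inverse \<open>m\<close>. Then
  \<open>r = m * (t * G)\<close> is an idempotent below \<open>G\<close> with the trace of
  \<open>G\<close>, so \<open>r = G\<close> and the inverse is two-sided.\<close>

lemma soc_square_left:
  fixes t :: 'a
  assumes t: "t \<in> soc_span" "t = t * t * z"
  obtains m where "t = m * t * t"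
proof -
  obtain D where D: "frame D" "\<Sum>D * t = t" "\<And>d. d \<in> D \<Longrightarrow> d \<in> range ((*) t)"
    using t(1) by (rule frame_of_range[OF semisimple]) blast
  have "\<forall>d\<in>D. \<exists>z. d = t * z"
    using D(3) by auto
  then obtain w where "\<forall>d\<in>D. d = t * w d"
    by metis
  hence "\<Sum>D = t * (\<Sum>d\<in>D. w d)"
    by (simp add: sum_distrib_left)
  then obtain w where w: "\<Sum>D = t * w"
    by blast
  define G where "G = \<Sum>D"
  have G: "G * G = G" "G * t = t" "G = t * w"
    unfolding G_def by (fact frame_sum_idem[OF D(1)] D(2) w)+
  define m where "m = t * z * w * G"
  have "t * G * m = t * (G * t) * z * w * G"
    by (simp add: m_def mult.assoc)
  also have "\<dots> = t * w * G"
    by (simp only: G(2) t(2)[symmetric])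
  finally have tGm: "t * G * m = G"
    using G(1,3) by simp
  define r where "r = m * (t * G)"
  have mG: "m * G = m" "G * m = m"
    by (simp_all add: m_def mult.assoc G(1)) (simp add: G(2) flip: mult.assoc)
  have GtG: "G * (t * G) = t * G"
    by (simp add: G(2) flip: mult.assoc)
  have rG: "r * G = r" "G * r = r"
    by (simp add: r_def mult.assoc G(1)) (simp add: r_def mG flip: mult.assoc)
  have "r * r = m * (t * G * m) * (t * G)"
    by (simp add: r_def mult.assoc)
  hence rr: "r * r = r"
    by (simp add: tGm mG r_def)
  obtain E where E: "frame E" "\<And>x. x \<in> {G} \<Longrightarrow> \<Sum>E * x = x" "\<And>x. x \<in> {G} \<Longrightarrow> x * \<Sum>E = x"
    by (rule frame_common_unit[OF semisimple, of "{G}"])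
      (use frame_sum_soc_span D(1) in \<open>auto simp: G_def\<close>)
  have E': "\<Sum>E * G = G" "G * \<Sum>E = G" "\<Sum>E * m = m" "m * \<Sum>E = m" "\<Sum>E * r = r" "r * \<Sum>E = r"
    using E(2,3)[of G] mG rG by (metis insertI1 mult.assoc)+
  have "frame_trace E (t * G * m) = frame_trace E (m * (t * G))"
    by (rule frame_trace_commute[OF E(1) E'(3,4)])
  hence "frame_trace E (G - r) = 0"
    by (simp add: tGm r_def frame_trace_diff E)
  hence "G - r = 0"
    using E' rG rr G(1) D(1) E(1)
    by (intro idempotent_frame_trace_zero[of E])
      (auto simp: left_diff_distrib right_diff_distrib r_def G_def
        intro!: soc_span_diff soc_span_mult_left frame_sum_soc_span)
  hence "t = r * t"
    using G(2) by simp
  hence "t = m * t * t"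
    by (simp add: r_def mult.assoc G(2))
  thus ?thesis
    using that by blast
qed

lemma soc_power_drazin:
  fixes f :: 'a
  assumes f: "f ^ n \<in> soc_span" "n \<ge> 1"
  obtains b k where "b * f * b = b" "f * b = b * f" "f ^ k * b * f = f ^ k"
proof -
  obtain k z where k: "k \<ge> 1" "(f ^ n) ^ k = (f ^ n) ^ k * (f ^ n) ^ k * z"
    using soc_power_square_right[OF f(1)] .
  define N where "N = n * k"
  have N: "N \<ge> 1" "f ^ N = f ^ N * f ^ N * z"
    using k f by (simp_all add: N_def power_mult)
  have "f ^ N = f ^ n * f ^ (n * (k - 1))"
    using k(1) by (simp add: N_def flip: power_add)
      (metis Suc_diff_1 mult_Suc_right less_eq_Suc_le One_nat_def)
  hence "f ^ N \<in> soc_span"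
    using f by (simp add: soc_span_mult_right)
  then obtain m where m: "f ^ N = m * f ^ N * f ^ N"
    using soc_square_left N(2) by blast
  obtain M where M: "N = Suc M"
    using N(1) by (cases N) auto
  \<comment> \<open>As \<open>N \<ge> 1\<close>, the exponent \<open>2 * N\<close> is at least
    \<open>Suc N\<close>; regularity of the power \<open>f ^ N\<close> thus becomes regularity of
    \<open>f\<close> itself.\<close>
  have "f ^ N * f ^ N = f ^ Suc N * f ^ M" "f ^ N * f ^ N = f ^ M * f ^ Suc N"
    unfolding power_add[symmetric] by (simp_all add: M)
  hence "f ^ N = f ^ Suc N * (f ^ M * z)" "f ^ N = (m * f ^ M) * f ^ Suc N"
    using N(2) m by (simp_all only: mult.assoc)
  thus ?thesis
    using strongly_pi_regular_drazin that by blast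
qed

end


section \<open>Spectral decomposition in the socle\<close>

text \<open>The decomposition of \<open>c\<close> into generalised eigenspaces within the corner of
  \<open>r\<close>. The set \<open>S\<close> may contain 0; the clause
  \<open>p \<nu> \<noteq> 0\<close> restricts it to actual spectral values.\<close>

definition spectral_decomposition ::
    "'a::complex_banach_algebra \<Rightarrow> 'a \<Rightarrow> complex set \<Rightarrow> (complex \<Rightarrow> 'a) \<Rightarrow> bool" where
  "spectral_decomposition r c S p \<longleftrightarrow> finite S \<and> r = (\<Sum>\<nu>\<in>S. p \<nu>) \<and>
    (\<forall>\<nu>\<in>S. p \<nu> * p \<nu> = p \<nu> \<and> p \<nu> \<noteq> 0 \<and> p \<nu> * c = c * p \<nu> \<and> (\<exists>m. (c * p \<nu> - \<nu> *\<^sub>C p \<nu>) ^ m = 0)) \<and>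
    (\<forall>\<nu>\<in>S. \<forall>\<mu>\<in>S. \<nu> \<noteq> \<mu> \<longrightarrow> p \<nu> * p \<mu> = 0)"

lemma spectral_decomposition_absorb:
  assumes "spectral_decomposition r c S p" "\<nu> \<in> S"
  shows "r * p \<nu> = p \<nu>" "p \<nu> * r = p \<nu>"
proof -
  have S: "finite S" "r = (\<Sum>\<mu>\<in>S. p \<mu>)" "p \<nu> * p \<nu> = p \<nu>"
      "\<And>\<mu>. \<mu> \<in> S \<Longrightarrow> \<mu> \<noteq> \<nu> \<Longrightarrow> p \<mu> * p \<nu> = 0 \<and> p \<nu> * p \<mu> = 0"
    using assms by (auto simp: spectral_decomposition_def)
  have "r * p \<nu> = (\<Sum>\<mu>\<in>S. p \<mu> * p \<nu>)" "p \<nu> * r = (\<Sum>\<mu>\<in>S. p \<nu> * p \<mu>)"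
    unfolding S(2) by (rule sum_distrib_right, rule sum_distrib_left)
  moreover have "(\<Sum>\<mu>\<in>S. p \<mu> * p \<nu>) = (\<Sum>\<mu>\<in>S. if \<mu> = \<nu> then p \<nu> else 0)"
      "(\<Sum>\<mu>\<in>S. p \<nu> * p \<mu>) = (\<Sum>\<mu>\<in>S. if \<mu> = \<nu> then p \<nu> else 0)"
    by (intro sum.cong refl; use S(3,4) in auto)+
  ultimately show "r * p \<nu> = p \<nu>" "p \<nu> * r = p \<nu>"
    using S(1) assms(2) by (simp_all add: sum.delta)
qed

context
  assumes semisimple: "jacobson_radical = ({0} :: 'a::complex_banach_algebra set)"
begin

lemma corner_eigenvalue:
  fixes r c :: 'a
  assumes r: "r * r = r" "r \<noteq> 0" "r * c = c" "c * r = c"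
  obtains \<nu> where "\<nexists>y. (\<nu> *\<^sub>C r - c) * y = r \<and> y * (\<nu> *\<^sub>C r - c) = r"
proof (rule ccontr)
  assume "\<not> thesis"
  hence "\<forall>\<nu>. \<exists>y. (\<nu> *\<^sub>C r - c) * y = r \<and> y * (\<nu> *\<^sub>C r - c) = r"
    using that by blast
  then obtain y where y: "\<And>\<nu>. (\<nu> *\<^sub>C r - c) * y \<nu> = r" "\<And>\<nu>. y \<nu> * (\<nu> *\<^sub>C r - c) = r"
    by metis
  interpret norm: algebra_seminorm "norm :: 'a \<Rightarrow> real"
    by unfold_locales (auto simp: norm_triangle_ineq norm_mult_ineq norm_scaleC)
  \<comment> \<open>The inverses \<open>y\<close> need not lie in the corner, so they are compressed
    to it.\<close>
  define w where "w \<nu> = r * y \<nu> * r" for \<nu>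
  have ur: "(\<nu> *\<^sub>C r - c) * r = \<nu> *\<^sub>C r - c" "r * (\<nu> *\<^sub>C r - c) = \<nu> *\<^sub>C r - c" for \<nu>
    by (simp_all add: left_diff_distrib right_diff_distrib scaleC_simps r)
  have "norm r = 0"
  proof (rule norm.corner_spectrum_nonempty[of w r c])
    fix \<nu>
    have "w \<nu> * (\<nu> *\<^sub>C r - c) = r * (y \<nu> * (\<nu> *\<^sub>C r - c))"
      unfolding w_def by (simp only: mult.assoc ur)
    thus "norm (w \<nu> * (\<nu> *\<^sub>C r - c) - r) = 0"
      by (simp add: y r)
    have "(\<nu> *\<^sub>C r - c) * w \<nu> = ((\<nu> *\<^sub>C r - c) * r) * y \<nu> * r"
      unfolding w_def by (simp only: mult.assoc)
    thus "norm ((\<nu> *\<^sub>C r - c) * w \<nu> - r) = 0"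
      unfolding ur by (simp add: y r)
    show "norm (r * w \<nu> - w \<nu>) = 0" "norm (w \<nu> * r - w \<nu>) = 0"
      unfolding w_def by (simp_all add: r mult.assoc) (simp add: r flip: mult.assoc)
  qed
  thus False using r by simp
qed

text \<open>Induction on the rank of \<open>r\<close>. Take a spectral value \<nu> of
  \<open>c\<close> in the corner and a Drazin inverse \<open>b\<close> of
  \<open>s = c - \<nu> r\<close>. It splits \<open>r\<close> into \<open>a = s * b\<close>, on which
  \<open>s\<close> is invertible, and \<open>p = r - a\<close>, on which \<open>s\<close> is
  nilpotent. Since \<open>p \<noteq> 0\<close>, the rank of \<open>a\<close> is smaller, and the
  hypothesis applies to \<open>c * a\<close> in the corner of \<open>a\<close>.\<close>

lemma spectral_decomposition_exists:
  fixes r c :: 'a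
  assumes E: "frame E" and r: "r * r = r" "r \<in> soc_span" "\<Sum>E * r = r" "r * \<Sum>E = r"
    and c: "r * c = c" "c * r = c"
  shows "\<exists>S p. spectral_decomposition r c S p"
  using r c
proof (induction "alg_rank r" arbitrary: r c rule: less_induct)
  case (less r c)
  note r = less.prems(1-4) and c = less.prems(5,6)
  show ?case
  proof (cases "r = 0")
    case True
    have "spectral_decomposition r c {} (\<lambda>_. 0)"
      by (simp add: spectral_decomposition_def True)
    thus ?thesis by blast
  next
    case False
    obtain \<nu> where \<nu>: "\<nexists>y. (\<nu> *\<^sub>C r - c) * y = r \<and> y * (\<nu> *\<^sub>C r - c) = r"
      using corner_eigenvalue[OF r(1) False c] .
    define s where "s = c - \<nu> *\<^sub>C r"
    have cs: "c = s + \<nu> *\<^sub>C r"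
      by (simp add: s_def)
    have rs: "r * s = s" "s * r = s"
      by (simp_all add: s_def left_diff_distrib right_diff_distrib scaleC_simps r c)
    have "s \<in> soc_span"
      using soc_span_mult_right[OF r(2), of s] by (simp add: rs)
    then obtain b k where b: "b * s * b = b" "s * b = b * s" "s ^ k * b * s = s ^ k"
      using soc_power_drazin[OF semisimple, of s 1] by auto
    define a where "a = s * b"
    define p where "p = r - a"
    have as: "a = b * s"
      by (simp add: a_def b)
    have aa: "a * a = a"
      unfolding a_def using b(1) by (simp add: mult.assoc)
    have ra: "r * a = a" "a * r = a"
      by (simp add: a_def rs flip: mult.assoc) (simp add: as rs mult.assoc)
    have sa: "s * a = a * s"
      unfolding as by (simp add: b(2) flip: mult.assoc)
    have ca: "c * a = a * c"
      by (simp add: cs sa ra distrib_left distrib_right scaleC_simps)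
    have pp: "p * p = p" and pa: "p * a = 0" "a * p = 0" and rp: "r * p = p" "p * r = p"
      by (simp_all add: p_def left_diff_distrib right_diff_distrib ra aa r)
    have ps: "p * s = s * p" and pc: "p * c = c * p"
      by (simp_all add: p_def left_diff_distrib right_diff_distrib rs sa ca c)
    have u: "c * p - \<nu> *\<^sub>C p = s * p"
      by (simp add: s_def left_diff_distrib scaleC_simps rp)
    have p0: "p \<noteq> 0"
    proof
      assume "p = 0"
      hence ar: "s * b = r" "b * s = r"
        by (simp_all add: p_def a_def b(2))
      define y where "y = - (r * b * r)"
      have u': "\<nu> *\<^sub>C r - c = - s"
        by (simp add: s_def)
      have "(\<nu> *\<^sub>C r - c) * y = (s * r) * b * r" "y * (\<nu> *\<^sub>C r - c) = r * b * (r * s)"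
        unfolding u' y_def by (simp_all add: mult.assoc)
      hence "(\<nu> *\<^sub>C r - c) * y = r" "y * (\<nu> *\<^sub>C r - c) = r"
        by (simp_all add: rs ar r mult.assoc)
      thus False
        using \<nu> by blast
    qed
    have pow: "(s * p) ^ Suc j = s ^ Suc j * p" for j
    proof (induction j)
      case (Suc j)
      have "(s * p) ^ Suc (Suc j) = s * (p * (s ^ Suc j * p))"
        using Suc by (simp add: mult.assoc)
      also have "p * (s ^ Suc j * p) = s ^ Suc j * p"
        using power_commuting_commutes[OF ps[symmetric], of "Suc j"] pp by (metis mult.assoc)
      finally show ?case
        by (simp add: mult.assoc)
    qed simp
    \<comment> \<open>The exponent \<open>Suc k\<close> guarantees a factor \<open>s\<close> that
      absorbs \<open>r\<close>, also when \<open>k = 0\<close>.\<close>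
    have "s ^ Suc k * a = s ^ Suc k"
      using b(3) by (simp add: as mult.assoc)
    hence "s ^ Suc k * p = 0"
      using rs by (simp add: p_def right_diff_distrib power_Suc2 mult.assoc del: power_Suc)
    hence nil: "(c * p - \<nu> *\<^sub>C p) ^ Suc k = 0"
      unfolding u pow .
    have a_soc: "a \<in> soc_span"
      using soc_span_mult_right[OF r(2), of a] by (simp add: ra)
    have Ea: "\<Sum>E * a = a" "a * \<Sum>E = a"
      using r ra by (metis mult.assoc)+
    have p_soc: "p \<in> soc_span"
      unfolding p_def by (intro soc_span_diff r a_soc)
    have Ep: "\<Sum>E * p = p" "p * \<Sum>E = p"
      using r rp by (metis mult.assoc)+
    have "frame_trace E r = frame_trace E a + frame_trace E p"
      by (simp add: p_def frame_trace_diff E)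
    hence "(of_nat (alg_rank r) :: complex) = of_nat (alg_rank a) + of_nat (alg_rank p)"
      using frame_trace_idempotent[OF semisimple E] r aa a_soc Ea pp p_soc Ep by simp
    hence "alg_rank r = alg_rank a + alg_rank p"
      by (metis of_nat_add of_nat_eq_iff)
    moreover have "alg_rank p \<noteq> 0"
      using alg_rank_eq_0D[OF semisimple pp p_soc] p0 by blast
    ultimately have "alg_rank a < alg_rank r"
      by simp
    moreover have aca: "a * (c * a) = c * a" "c * a * a = c * a"
      by (metis aa ca mult.assoc)+
    ultimately obtain S q where q: "spectral_decomposition a (c * a) S q"
      using less.hyps[of a "c * a"] aa a_soc Ea by blast
    have aq: "a * q \<mu> = q \<mu>" "q \<mu> * a = q \<mu>" if "\<mu> \<in> S" for \<mu>
      using spectral_decomposition_absorb[OF q that] .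
    have caq: "c * a * q \<mu> = c * q \<mu>" "q \<mu> * (c * a) = q \<mu> * c" if "\<mu> \<in> S" for \<mu>
      using aq[OF that] by (simp_all add: mult.assoc) (simp add: ca flip: mult.assoc)
    have qD: "q \<mu> * q \<mu> = q \<mu>" "q \<mu> \<noteq> 0" "q \<mu> * c = c * q \<mu>"
      "\<exists>m. (c * q \<mu> - \<mu> *\<^sub>C q \<mu>) ^ m = 0" if "\<mu> \<in> S" for \<mu>
    proof -
      have "q \<mu> * q \<mu> = q \<mu> \<and> q \<mu> \<noteq> 0 \<and> q \<mu> * (c * a) = (c * a) * q \<mu> \<and>
          (\<exists>m. (c * a * q \<mu> - \<mu> *\<^sub>C q \<mu>) ^ m = 0)"
        using q that unfolding spectral_decomposition_def by blast
      thus "q \<mu> * q \<mu> = q \<mu>" "q \<mu> \<noteq> 0" "q \<mu> * c = c * q \<mu>"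
          "\<exists>m. (c * q \<mu> - \<mu> *\<^sub>C q \<mu>) ^ m = 0"
        unfolding caq[OF that] by blast+
    qed
    have pq: "p * q \<mu> = 0" "q \<mu> * p = 0" if "\<mu> \<in> S" for \<mu>
      using aq[OF that] pa by (metis mult.assoc mult_zero_left mult_zero_right)+
    \<comment> \<open>On a second idempotent for the same \<nu>, the element \<open>s\<close> would
      be both nilpotent and left invertible through \<open>b\<close>.\<close>
    have "\<nu> \<notin> S"
    proof
      assume \<nu>S: "\<nu> \<in> S"
      define w where "w = c * q \<nu> - \<nu> *\<^sub>C q \<nu>"
      have q\<nu>: "q \<nu> * q \<nu> = q \<nu>" "q \<nu> \<noteq> 0" "q \<nu> * c = c * q \<nu>" "\<exists>m. w ^ m = 0"
        using qD[OF \<nu>S] by (simp_all add: w_def)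
      then obtain m where m: "w ^ m = 0"
        by blast
      have rq: "r * q \<nu> = q \<nu>"
        using aq[OF \<nu>S] ra by (metis mult.assoc)
      have w: "w = s * q \<nu>"
        by (simp add: w_def s_def left_diff_distrib scaleC_simps rq)
      have "b * w = q \<nu>"
        using aq[OF \<nu>S] by (simp add: w as mult.assoc)
      moreover have "q \<nu> * w = w"
        by (simp add: w_def right_diff_distrib scaleC_simps q\<nu> flip: mult.assoc)
          (simp add: q\<nu> mult.assoc)
      ultimately show False
        using nilpotent_left_invertible[of "q \<nu>" b w m] m q\<nu> by simp
    qed
    have "spectral_decomposition r c (insert \<nu> S) (q(\<nu> := p))"
      unfolding spectral_decomposition_def
    proof (intro conjI ballI impI)
      have fin: "finite S" and "a = (\<Sum>\<mu>\<in>S. q \<mu>)"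
        using q by (auto simp: spectral_decomposition_def)
      hence "a = (\<Sum>\<mu>\<in>S. (q(\<nu> := p)) \<mu>)"
        using \<open>\<nu> \<notin> S\<close> by (simp cong: sum.cong_simp) (auto intro: sum.cong)
      thus "r = (\<Sum>\<mu>\<in>insert \<nu> S. (q(\<nu> := p)) \<mu>)"
        using fin \<open>\<nu> \<notin> S\<close> by (simp add: p_def)
      show "finite (insert \<nu> S)"
        using fin by simp
      fix \<mu> assume \<mu>: "\<mu> \<in> insert \<nu> S"
      let ?q = "q(\<nu> := p)"
      have "?q \<mu> * ?q \<mu> = ?q \<mu> \<and> ?q \<mu> \<noteq> 0 \<and> ?q \<mu> * c = c * ?q \<mu> \<and> (\<exists>m. (c * ?q \<mu> - \<mu> *\<^sub>C ?q \<mu>) ^ m = 0)"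
      proof (cases "\<mu> = \<nu>")
        case True
        thus ?thesis
          using pp p0 pc nil by (auto intro!: exI[of _ "Suc k"] simp del: power_Suc)
      next
        case False
        hence "\<mu> \<in> S" using \<mu> by simp
        thus ?thesis
          using qD[OF \<open>\<mu> \<in> S\<close>] False by simp
      qed
      thus "?q \<mu> * ?q \<mu> = ?q \<mu>" "?q \<mu> \<noteq> 0" "?q \<mu> * c = c * ?q \<mu>"
        "\<exists>m. (c * ?q \<mu> - \<mu> *\<^sub>C ?q \<mu>) ^ m = 0"
        by blast+
      fix \<mu>' assume "\<mu>' \<in> insert \<nu> S" "\<mu> \<noteq> \<mu>'"
      thus "?q \<mu> * ?q \<mu>' = 0"
        using \<mu> pq q \<open>\<nu> \<notin> S\<close> by (auto simp: spectral_decomposition_def)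
    qed
    thus ?thesis by blast
  qed
qed

end


section \<open>The algebra as a ring\<close>

lemma alg_sel [simp]:
  "carrier alg = UNIV" "x \<otimes>\<^bsub>alg\<^esub> y = x * y" "x \<oplus>\<^bsub>alg\<^esub> y = x + y" "\<one>\<^bsub>alg\<^esub> = 1" "\<zero>\<^bsub>alg\<^esub> = 0"
  by (simp_all add: ring_of_type_algebra_def)

lemma ring_alg: "ring (alg :: 'a::complex_banach_algebra ring)"
proof (intro ringI abelian_groupI monoidI)
  show "\<exists>y\<in>carrier alg. y \<oplus>\<^bsub>alg\<^esub> x = \<zero>\<^bsub>alg\<^esub>" for x :: 'a
    by (auto intro: exI[of _ "- x"])
qed (auto simp: algebra_simps)

lemma alg_minus [simp]: "x \<ominus>\<^bsub>alg\<^esub> y = x - y"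
proof -
  interpret ring "alg :: 'a ring" by (rule ring_alg)
  have "\<ominus>\<^bsub>alg\<^esub> y = - y"
    by (rule minus_equality) auto
  thus ?thesis by (simp add: a_minus_def)
qed

lemma alg_pow [simp]: "x [^]\<^bsub>alg\<^esub> (n::nat) = x ^ n"
  by (induction n) (simp_all add: power_commutes)

lemma alg_Units: "x \<in> Units alg \<longleftrightarrow> (\<exists>y. x * y = 1 \<and> y * x = 1)"
  by (auto simp: Units_def)

lemma alg_inv:
  assumes "x * y = 1" "y * x = 1"
  shows "inv\<^bsub>alg\<^esub> x = y"
  unfolding m_inv_def
proof (rule the_equality)
  fix z assume "z \<in> carrier alg \<and> x \<otimes>\<^bsub>alg\<^esub> z = \<one>\<^bsub>alg\<^esub> \<and> z \<otimes>\<^bsub>alg\<^esub> x = \<one>\<^bsub>alg\<^esub>"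
  hence "z * x = 1" by simp
  thus "z = y"
    using assms by (metis mult.assoc mult_1 mult_1_right)
qed (use assms in simp)

lemma spectrum_iff: "z \<in> spectrum a \<longleftrightarrow> \<not> (\<exists>y. (z *\<^sub>C 1 - a) * y = 1 \<and> y * (z *\<^sub>C 1 - a) = 1)"
  by (simp add: spectrum_def ring_spectrum_def alg_Units)


section \<open>Resolvent, Riesz idempotents and trace of elements of the socle\<close>

lemma bounded_linear_scaleC_left: "bounded_linear (\<lambda>w. w *\<^sub>C (x :: 'a::complex_banach_algebra))"
proof (rule bounded_linear_intro[of _ "norm x"])
  show "(r *\<^sub>R w) *\<^sub>C x = r *\<^sub>R (w *\<^sub>C x)" for r w
    by (simp only: scaleR_conv_of_real[of r w] scaleC_of_real[symmetric] scaleC_scaleC)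
qed (simp_all add: scaleC_add_left norm_scaleC mult_ac)

lemma has_integral_contour_scaleC:
  fixes x :: "'a::complex_banach_algebra"
  assumes "(h has_contour_integral I) \<gamma>"
  shows "((\<lambda>t. vector_derivative \<gamma> (at t within {0..1}) *\<^sub>C (h (\<gamma> t) *\<^sub>C x)) has_integral I *\<^sub>C x) {0..1}"
  using has_integral_linear[OF assms[unfolded has_contour_integral_def] bounded_linear_scaleC_left[of x]]
  by (simp add: o_def mult.commute)

text \<open>At the centre this is Cauchy's formula for the derivatives of the constant 1; for \<nu>
  outside the circle the integrand is holomorphic in the disc that reaches up to \<nu>.\<close>

lemma has_contour_integral_circlepath_power:
  assumes "r > 0" "\<nu> = \<mu> \<or> r < cmod (\<nu> - \<mu>)"
  shows "((\<lambda>z. 1 / (z - \<nu>) ^ Suc k) has_contour_integral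
    (if \<nu> = \<mu> \<and> k = 0 then 2 * pi * \<i> else 0)) (circlepath \<mu> r)"
proof (cases "\<nu> = \<mu>")
  case True
  have "((\<lambda>u. 1 / (u - \<mu>) ^ Suc k) has_contour_integral
     ((2 * pi * \<i>) / fact k * (deriv ^^ k) (\<lambda>_. 1) \<mu>)) (circlepath \<mu> r)"
    using assms by (intro Cauchy_has_contour_integral_higher_derivative_circlepath) auto
  thus ?thesis
    using True by (simp add: higher_deriv_const split: if_splits)
next
  case False
  define d where "d = cmod (\<nu> - \<mu>)"
  have "((\<lambda>z. 1 / (z - \<nu>) ^ Suc k) has_contour_integral 0) (circlepath \<mu> r)"
  proof (rule Cauchy_theorem_convex_simple[of _ "ball \<mu> d"])
    show "(\<lambda>z. 1 / (z - \<nu>) ^ Suc k) holomorphic_on ball \<mu> d"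
      by (intro holomorphic_intros) (auto simp: d_def dist_norm norm_minus_commute)
    show "path_image (circlepath \<mu> r) \<subseteq> ball \<mu> d"
      using assms False by (auto simp: d_def dist_norm norm_minus_commute)
  qed auto
  thus ?thesis
    using False by simp
qed

text \<open>The partial fractions of \<open>(z - c)^-1\<close>. On \<open>1 - r\<close> the element
  \<open>c\<close> acts as 0, and on \<open>p \<nu>\<close> it is \<nu> plus a nilpotent, whose
  geometric series stops. The factor \<open>p \<nu>\<close> at the end turns the zeroth power into
  \<open>p \<nu>\<close> instead of 1.\<close>

definition resolvent_expansion ::
    "'a::complex_banach_algebra \<Rightarrow> 'a \<Rightarrow> complex set \<Rightarrow> (complex \<Rightarrow> 'a) \<Rightarrow> nat \<Rightarrow> complex \<Rightarrow> 'a" where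
  "resolvent_expansion r c S p m z = (1 / z) *\<^sub>C (1 - r) +
    (\<Sum>\<nu>\<in>S. \<Sum>k<m. (1 / (z - \<nu>) ^ Suc k) *\<^sub>C ((c * p \<nu> - \<nu> *\<^sub>C p \<nu>) ^ k * p \<nu>))"

text \<open>From \<open>x * p \<nu> = (z - \<nu>) p \<nu> - u \<nu>\<close> each inner sum,
  multiplied by \<open>x = z - c\<close>, telescopes to \<open>p \<nu>\<close>, and these
  idempotents add up to \<open>r\<close>.\<close>

lemma resolvent_expansion_inverse:
  fixes c :: "'a::complex_banach_algebra"
  assumes S: "spectral_decomposition r c S p" and c: "r * c = c" "c * r = c"
    and m: "\<And>\<nu>. \<nu> \<in> S \<Longrightarrow> (c * p \<nu> - \<nu> *\<^sub>C p \<nu>) ^ m = 0" and z: "z \<noteq> 0" "z \<notin> S"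
  shows "(z *\<^sub>C 1 - c) * resolvent_expansion r c S p m z = 1"
    and "resolvent_expansion r c S p m z * (z *\<^sub>C 1 - c) = 1"
proof -
  define x where "x = z *\<^sub>C 1 - c"
  define u where "u \<nu> = c * p \<nu> - \<nu> *\<^sub>C p \<nu>" for \<nu>
  have p: "p \<nu> * p \<nu> = p \<nu>" "p \<nu> * c = c * p \<nu>" if "\<nu> \<in> S" for \<nu>
    using S that by (auto simp: spectral_decomposition_def)
  have px: "p \<nu> * x = x * p \<nu>" and xp: "x * p \<nu> = (z - \<nu>) *\<^sub>C p \<nu> - u \<nu>" if "\<nu> \<in> S" for \<nu>
    using p[OF that] by (simp_all add: x_def u_def algebra_simps scaleC_simps)
  have xu: "x * u \<nu> = u \<nu> * x" and pu: "p \<nu> * u \<nu> = u \<nu>" "u \<nu> * p \<nu> = u \<nu>" if "\<nu> \<in> S" for \<nu>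
  proof -
    have pp: "p \<nu> * (p \<nu> * y) = p \<nu> * y" "p \<nu> * (c * y) = c * (p \<nu> * y)" for y
      using p[OF that] by (metis mult.assoc)+
    show "x * u \<nu> = u \<nu> * x" "p \<nu> * u \<nu> = u \<nu>" "u \<nu> * p \<nu> = u \<nu>"
      by (simp_all add: x_def u_def algebra_simps scaleC_simps p[OF that] pp mult.assoc)
  qed
  have comm: "(u \<nu> ^ k * p \<nu>) * x = x * (u \<nu> ^ k * p \<nu>)" if "\<nu> \<in> S" for \<nu> k
    using px[OF that] power_commuting_commutes[OF xu[OF that, symmetric], of k] by (metis mult.assoc)
  have step: "x * ((1 / (z - \<nu>) ^ Suc k) *\<^sub>C (u \<nu> ^ k * p \<nu>)) =
      (1 / (z - \<nu>) ^ k) *\<^sub>C (u \<nu> ^ k * p \<nu>) - (1 / (z - \<nu>) ^ Suc k) *\<^sub>C (u \<nu> ^ Suc k * p \<nu>)"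
    if "\<nu> \<in> S" for \<nu> k
  proof -
    have "x * (u \<nu> ^ k * p \<nu>) = u \<nu> ^ k * (x * p \<nu>)"
      using power_commuting_commutes[OF xu[OF that, symmetric], of k] by (metis mult.assoc)
    also have "\<dots> = (z - \<nu>) *\<^sub>C (u \<nu> ^ k * p \<nu>) - u \<nu> ^ Suc k * p \<nu>"
      using pu[OF that] by (simp add: xp[OF that] right_diff_distrib scaleC_simps power_Suc2 mult.assoc
        del: power_Suc)
    finally show ?thesis
      using z that by (auto simp: scaleC_simps cvec.scale_right_diff_distrib)
  qed
  have inner: "(\<Sum>k<n. x * ((1 / (z - \<nu>) ^ Suc k) *\<^sub>C (u \<nu> ^ k * p \<nu>))) =
      p \<nu> - (1 / (z - \<nu>) ^ n) *\<^sub>C (u \<nu> ^ n * p \<nu>)" if "\<nu> \<in> S" for \<nu> n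
    by (induction n) (simp_all add: step[OF that] del: power_Suc)
  have "x * resolvent_expansion r c S p m z = (1 - r) +
      (\<Sum>\<nu>\<in>S. \<Sum>k<m. x * ((1 / (z - \<nu>) ^ Suc k) *\<^sub>C (u \<nu> ^ k * p \<nu>)))"
  proof -
    have "x * ((1 / z) *\<^sub>C (1 - r)) = 1 - r"
      using z c by (simp add: x_def scaleC_simps left_diff_distrib right_diff_distrib
        cvec.scale_right_diff_distrib)
    thus ?thesis
      unfolding resolvent_expansion_def u_def by (simp only: distrib_left sum_distrib_left)
  qed
  also have "\<dots> = (1 - r) + (\<Sum>\<nu>\<in>S. p \<nu>)"
  proof (intro arg_cong2[of _ _ _ _ "(+)"] refl sum.cong)
    fix \<nu> assume "\<nu> \<in> S"
    thus "(\<Sum>k<m. x * ((1 / (z - \<nu>) ^ Suc k) *\<^sub>C (u \<nu> ^ k * p \<nu>))) = p \<nu>"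
      using inner[of \<nu> m] m[of \<nu>] by (simp add: u_def del: power_Suc)
  qed
  also have "\<dots> = 1"
    using S by (simp add: spectral_decomposition_def)
  finally show 1: "(z *\<^sub>C 1 - c) * resolvent_expansion r c S p m z = 1"
    by (simp add: x_def)
  have "resolvent_expansion r c S p m z * x = x * resolvent_expansion r c S p m z"
  proof -
    have "(1 - r) * x = x * (1 - r)"
      using c by (simp add: x_def left_diff_distrib right_diff_distrib scaleC_simps
        cvec.scale_right_diff_distrib)
    thus ?thesis
      unfolding resolvent_expansion_def u_def[symmetric]
      by (simp add: distrib_left distrib_right sum_distrib_left sum_distrib_right scaleC_simps comm
        del: power_Suc cong: sum.cong)
  qed
  with 1 show "resolvent_expansion r c S p m z * (z *\<^sub>C 1 - c) = 1"
    by (simp add: x_def)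
qed

lemma spectral_decomposition_nilpotency_bound:
  assumes "spectral_decomposition r c S p"
  obtains m where "m > 0" "\<And>\<nu>. \<nu> \<in> S \<Longrightarrow> (c * p \<nu> - \<nu> *\<^sub>C p \<nu>) ^ m = 0"
proof -
  define u where "u \<nu> = c * p \<nu> - \<nu> *\<^sub>C p \<nu>" for \<nu>
  have "\<forall>\<nu>\<in>S. \<exists>m. u \<nu> ^ m = 0" and fin: "finite S"
    using assms by (auto simp: spectral_decomposition_def u_def)
  then obtain n where n: "\<And>\<nu>. \<nu> \<in> S \<Longrightarrow> u \<nu> ^ n \<nu> = 0"
    by metis
  \<comment> \<open>The sum exceeds every single exponent, and \<open>Suc\<close> makes
    \<open>m\<close> positive, so that the term \<open>k = 0\<close> with the residue occurs in the
    expansion.\<close>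
  define m where "m = Suc (\<Sum>\<nu>\<in>S. n \<nu>)"
  have "u \<nu> ^ m = 0" if "\<nu> \<in> S" for \<nu>
  proof -
    have "n \<nu> \<le> m"
      using member_le_sum[of \<nu> S n] fin that by (simp add: m_def)
    then obtain j where "m = n \<nu> + j"
      using le_Suc_ex by blast
    thus ?thesis
      by (simp add: power_add n that)
  qed
  thus ?thesis
    using that[of m] by (simp add: m_def u_def)
qed

text \<open>The point 0 is set aside because it can enter the spectrum through \<open>1 - r\<close>
  alone. For \<open>z \<in> S\<close>, a left inverse of \<open>z - c\<close> would make the
  nilpotent part on \<open>p z\<close> left invertible, hence \<open>p z = 0\<close>.\<close>

lemma spectral_decomposition_spectrum:
  assumes S: "spectral_decomposition r c S p" and c: "r * c = c" "c * r = c"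
  shows "spectrum c - {0} = S - {0}"
proof -
  obtain m where m: "m > 0" "\<And>\<nu>. \<nu> \<in> S \<Longrightarrow> (c * p \<nu> - \<nu> *\<^sub>C p \<nu>) ^ m = 0"
    using spectral_decomposition_nilpotency_bound[OF S] by blast
  have "z \<notin> spectrum c" if "z \<noteq> 0" "z \<notin> S" for z
    using resolvent_expansion_inverse[OF S c m(2) that] by (auto simp: spectrum_iff)
  moreover have "z \<in> spectrum c" if "z \<in> S" for z
  proof (rule ccontr)
    assume "z \<notin> spectrum c"
    then obtain y where y: "y * (z *\<^sub>C 1 - c) = 1"
      by (auto simp: spectrum_iff)
    have p: "p z * p z = p z" "p z \<noteq> 0" "p z * c = c * p z"
      using S that by (auto simp: spectral_decomposition_def)
    let ?u = "c * p z - z *\<^sub>C p z"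
    have "- y * ?u = y * (z *\<^sub>C 1 - c) * p z"
      by (simp add: algebra_simps scaleC_simps)
    hence "p z = - y * ?u"
      by (simp add: y)
    moreover have "p z * ?u = p z * c * p z - z *\<^sub>C (p z * p z)"
      by (simp add: right_diff_distrib scaleC_simps mult.assoc)
    hence "p z * ?u = ?u"
      by (simp add: p mult.assoc)
    ultimately show False
      using nilpotent_left_invertible m(2)[OF that] p(2) by blast
  qed
  ultimately show ?thesis by blast
qed

text \<open>On a small circle around \<mu> only the simple pole at \<mu> contributes, with residue
  \<open>p \<mu>\<close>.\<close>

lemma riesz_idempotent_spectral_decomposition:
  fixes c :: "'a::complex_banach_algebra"
  assumes S: "spectral_decomposition r c S p" and c: "r * c = c" "c * r = c"
    and \<mu>: "\<mu> \<in> S" "\<mu> \<noteq> 0"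
  shows "riesz_idempotent \<mu> c = p \<mu>"
proof -
  obtain m where m: "m > 0" "\<And>\<nu>. \<nu> \<in> S \<Longrightarrow> (c * p \<nu> - \<nu> *\<^sub>C p \<nu>) ^ m = 0"
    using spectral_decomposition_nilpotency_bound[OF S] by blast
  define u where "u \<nu> k = (c * p \<nu> - \<nu> *\<^sub>C p \<nu>) ^ k * p \<nu>" for \<nu> k
  have fin: "finite S"
    using S by (simp add: spectral_decomposition_def)
  \<comment> \<open>The circle has to avoid 0 even if \<open>0 \<notin> S\<close>, because of the
    pole of \<open>(1 / z) *\<^sub>C (1 - r)\<close>.\<close>
  hence "\<exists>d>0. \<forall>\<nu>\<in>insert 0 S. \<nu> \<noteq> \<mu> \<longrightarrow> d \<le> dist \<mu> \<nu>"
    by (intro finite_set_avoid) simp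
  then obtain d where d: "d > 0" "\<And>\<nu>. \<nu> \<in> insert 0 S \<Longrightarrow> \<nu> \<noteq> \<mu> \<Longrightarrow> d \<le> dist \<mu> \<nu>"
    by blast
  have integral: "(1 / (2 * pi * \<i>)) *\<^sub>C
      alg_contour_integral (circlepath \<mu> \<rho>) (\<lambda>z. inv\<^bsub>alg\<^esub> (z *\<^sub>C 1 - c)) = p \<mu>"
    if \<rho>: "0 < \<rho>" "\<rho> < d" for \<rho>
  proof -
    let ?\<gamma> = "circlepath \<mu> \<rho>"
    let ?D = "\<lambda>t. vector_derivative ?\<gamma> (at t within {0..1})"
    have far: "\<nu> = \<mu> \<or> \<rho> < cmod (\<nu> - \<mu>)" if "\<nu> \<in> insert 0 S" for \<nu>
      using d(2)[OF that] \<rho> by (force simp: dist_norm norm_minus_commute)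
    have "((\<lambda>t. ?D t *\<^sub>C ((1 / (?\<gamma> t - 0) ^ Suc 0) *\<^sub>C (1 - r)) +
        (\<Sum>\<nu>\<in>S. \<Sum>k<m. ?D t *\<^sub>C ((1 / (?\<gamma> t - \<nu>) ^ Suc k) *\<^sub>C u \<nu> k))) has_integral
        (if 0 = \<mu> \<and> 0 = (0::nat) then 2 * pi * \<i> else 0) *\<^sub>C (1 - r) +
        (\<Sum>\<nu>\<in>S. \<Sum>k<m. (if \<nu> = \<mu> \<and> k = 0 then 2 * pi * \<i> else 0) *\<^sub>C u \<nu> k)) {0..1}"
      using fin far far[of 0] \<rho>
      by (intro has_integral_add has_integral_sum has_integral_contour_scaleC
          has_contour_integral_circlepath_power) auto
    also have "(\<lambda>t. ?D t *\<^sub>C ((1 / (?\<gamma> t - 0) ^ Suc 0) *\<^sub>C (1 - r)) +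
        (\<Sum>\<nu>\<in>S. \<Sum>k<m. ?D t *\<^sub>C ((1 / (?\<gamma> t - \<nu>) ^ Suc k) *\<^sub>C u \<nu> k))) =
        (\<lambda>t. ?D t *\<^sub>C resolvent_expansion r c S p m (?\<gamma> t))"
      unfolding resolvent_expansion_def u_def
      by (simp only: scaleC_add_right cvec.scale_sum_right) simp
    also have "(if 0 = \<mu> \<and> 0 = (0::nat) then 2 * pi * \<i> else 0) *\<^sub>C (1 - r) +
        (\<Sum>\<nu>\<in>S. \<Sum>k<m. (if \<nu> = \<mu> \<and> k = 0 then 2 * pi * \<i> else 0) *\<^sub>C u \<nu> k) =
        (\<Sum>\<nu>\<in>S. if \<nu> = \<mu> then (2 * pi * \<i>) *\<^sub>C u \<mu> 0 else 0)"
    proof -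
      have "(\<Sum>k<m. (if \<nu> = \<mu> \<and> k = 0 then 2 * pi * \<i> else 0) *\<^sub>C u \<nu> k) =
        (if \<nu> = \<mu> then (2 * pi * \<i>) *\<^sub>C u \<mu> 0 else 0)" for \<nu>
      proof -
        have "(\<Sum>k<m. (if \<nu> = \<mu> \<and> k = 0 then 2 * pi * \<i> else 0) *\<^sub>C u \<nu> k) =
          (\<Sum>k<m. if k = 0 then (if \<nu> = \<mu> then (2 * pi * \<i>) *\<^sub>C u \<mu> 0 else 0) else 0)"
          by (intro sum.cong) auto
        thus ?thesis
          using m(1) by (simp add: sum.delta)
      qed
      thus ?thesis using \<mu> by simp
    qed
    also have "\<dots> = (2 * pi * \<i>) *\<^sub>C p \<mu>"
      using fin \<mu> by (simp add: sum.delta u_def)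
    finally have "((\<lambda>t. ?D t *\<^sub>C resolvent_expansion r c S p m (?\<gamma> t)) has_integral
        (2 * pi * \<i>) *\<^sub>C p \<mu>) {0..1}" .
    moreover have "resolvent_expansion r c S p m (?\<gamma> t) = inv\<^bsub>alg\<^esub> (?\<gamma> t *\<^sub>C 1 - c)"
      if "t \<in> {0..1}" for t
    proof -
      have "?\<gamma> t \<in> path_image ?\<gamma>"
        using that by (simp add: path_image_def)
      hence "cmod (?\<gamma> t - \<mu>) = \<rho>"
        using \<rho> by (simp add: dist_norm norm_minus_commute)
      hence "?\<gamma> t \<notin> insert 0 S"
        using far[of "?\<gamma> t"] \<rho> by auto
      hence "?\<gamma> t \<noteq> 0" "?\<gamma> t \<notin> S"
        by auto
      thus ?thesis
        by (intro alg_inv[symmetric] resolvent_expansion_inverse[OF S c m(2)])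
    qed
    ultimately have "((\<lambda>t. ?D t *\<^sub>C inv\<^bsub>alg\<^esub> (?\<gamma> t *\<^sub>C 1 - c)) has_integral (2 * pi * \<i>) *\<^sub>C p \<mu>) {0..1}"
      by (subst has_integral_cong[symmetric]) auto
    hence "alg_contour_integral ?\<gamma> (\<lambda>z. inv\<^bsub>alg\<^esub> (z *\<^sub>C 1 - c)) = (2 * pi * \<i>) *\<^sub>C p \<mu>"
      unfolding alg_contour_integral_def by (rule integral_unique)
    thus ?thesis by simp
  qed
  have "\<forall>\<^sub>F \<rho> in at_right 0. 0 < \<rho> \<and> \<rho> < d"
    using d(1) by (auto simp: eventually_at_right_field)
  hence ev: "\<forall>\<^sub>F \<rho> in at_right 0. p \<mu> = (1 / (2 * pi * \<i>)) *\<^sub>C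
      alg_contour_integral (circlepath \<mu> \<rho>) (\<lambda>z. inv\<^bsub>alg\<^esub> (z *\<^sub>C 1 - c))"
    by (rule eventually_mono) (use integral in metis)
  show ?thesis
    unfolding riesz_idempotent_def
  proof (rule the_equality)
    fix q assume q: "\<forall>\<^sub>F \<rho> in at_right 0. q = (1 / (2 * pi * \<i>)) *\<^sub>C
      alg_contour_integral (circlepath \<mu> \<rho>) (\<lambda>z. inv\<^bsub>alg\<^esub> (z *\<^sub>C 1 - c))"
    have "\<forall>\<^sub>F \<rho>::real in at_right 0. q = p \<mu>"
      using eventually_conj[OF ev q] by (rule eventually_mono) simp
    thus "q = p \<mu>"
      by simp
  qed (fact ev)
qed

context
  assumes semisimple: "jacobson_radical = ({0} :: 'a::complex_banach_algebra set)"
begin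

text \<open>Split \<open>c\<close> along the decomposition of the unit \<open>\<Sum>E\<close>: on
  each \<open>p \<nu>\<close> the nilpotent part has trace 0, which leaves \<nu> times the
  rank.\<close>

lemma alg_trace_eq_frame_trace:
  fixes c :: 'a
  assumes E: "frame E" and c: "c \<in> soc_span" "\<Sum>E * c = c" "c * \<Sum>E = c"
  shows "alg_trace c = frame_trace E c"
proof -
  define r where "r = \<Sum>E"
  have r: "r * r = r" "r \<in> soc_span" "\<Sum>E * r = r" "r * \<Sum>E = r" "r * c = c" "c * r = c"
    using frame_sum_idem[OF E] frame_sum_soc_span[OF E] c by (simp_all add: r_def)
  obtain S p where S: "spectral_decomposition r c S p"
    using spectral_decomposition_exists[OF semisimple E r] by blast
  have fin: "finite S" and rsum: "r = (\<Sum>\<nu>\<in>S. p \<nu>)"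
    using S by (simp_all add: spectral_decomposition_def)
  have tr: "frame_trace E (c * p \<nu>) = \<nu> * of_nat (alg_rank (p \<nu>))" if "\<nu> \<in> S" for \<nu>
  proof -
    have p: "p \<nu> * p \<nu> = p \<nu>" "p \<nu> * c = c * p \<nu>" "r * p \<nu> = p \<nu>" "p \<nu> * r = p \<nu>"
      using S that spectral_decomposition_absorb[OF S that] by (auto simp: spectral_decomposition_def)
    define u where "u = c * p \<nu> - \<nu> *\<^sub>C p \<nu>"
    have p_soc: "p \<nu> \<in> soc_span"
      using soc_span_mult_right[OF r(2), of "p \<nu>"] by (simp add: p)
    have "u = (c - \<nu> *\<^sub>C 1) * p \<nu>"
      by (simp add: u_def left_diff_distrib scaleC_simps)
    hence "u \<in> soc_span"
      by (simp add: soc_span_mult_left p_soc)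
    moreover have "\<Sum>E * u = u" "u * \<Sum>E = u"
      unfolding r_def[symmetric] u_def
      by (simp_all add: left_diff_distrib right_diff_distrib scaleC_simps p mult.assoc)
        (simp add: r flip: mult.assoc)
    moreover have "\<exists>m. u ^ m = 0"
      using S that by (auto simp: spectral_decomposition_def u_def)
    ultimately have "frame_trace E u = 0"
      using frame_trace_nilpotent[OF semisimple E] by blast
    moreover have "frame_trace E (p \<nu>) = of_nat (alg_rank (p \<nu>))"
      using p by (intro frame_trace_idempotent[OF semisimple E] p_soc) (simp_all add: r_def)
    ultimately show ?thesis
      by (simp add: u_def frame_trace_diff frame_trace_scale E)
  qed
  have "alg_trace c = (\<Sum>\<mu>\<in>spectrum c - {0}. \<mu> * of_nat (alg_mult \<mu> c))"
  proof -
    have "finite (spectrum c - {0})"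
      using fin spectral_decomposition_spectrum[OF S r(5,6)] by simp
    hence "finite (spectrum c)"
      by simp
    thus ?thesis
      unfolding alg_trace_def by (intro sum.mono_neutral_right) auto
  qed
  also have "\<dots> = (\<Sum>\<mu>\<in>S - {0}. \<mu> * of_nat (alg_rank (p \<mu>)))"
    unfolding spectral_decomposition_spectrum[OF S r(5,6)] alg_mult_def
    by (intro sum.cong refl) (use riesz_idempotent_spectral_decomposition[OF S r(5,6)] in auto)
  also have "\<dots> = (\<Sum>\<mu>\<in>S. \<mu> * of_nat (alg_rank (p \<mu>)))"
    using fin by (intro sum.mono_neutral_left) auto
  also have "\<dots> = (\<Sum>\<mu>\<in>S. frame_trace E (c * p \<mu>))"
    using tr by simp
  also have "\<dots> = frame_trace E (c * r)"
    by (simp add: rsum sum_distrib_left frame_trace_sum E)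
  finally show ?thesis
    by (simp add: r)
qed

text \<open>One frame absorbs both \<open>b\<close> and the commutator: the latter to identify
  \<tau> with the frame trace, the former to commute the factors under it.\<close>

lemma alg_trace_commutator:
  fixes a b :: 'a
  assumes "b \<in> soc_span"
  shows "alg_trace (a * b - b * a) = 0"
proof -
  define c where "c = a * b - b * a"
  have c: "c \<in> soc_span"
    unfolding c_def using assms by (intro soc_span_diff soc_span_mult_left soc_span_mult_right)
  obtain E where E: "frame E" "\<And>x. x \<in> {b, c} \<Longrightarrow> \<Sum>E * x = x" "\<And>x. x \<in> {b, c} \<Longrightarrow> x * \<Sum>E = x"
    by (rule frame_common_unit[OF semisimple, of "{b, c}"]) (use assms c in auto)
  have "alg_trace c = frame_trace E c"
    using E c by (intro alg_trace_eq_frame_trace) auto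
  also have "\<dots> = 0"
    unfolding c_def using E by (simp add: frame_trace_diff frame_trace_commute[of E b])
  finally show ?thesis
    by (simp add: c_def)
qed

end


section \<open>Quotients by two-sided ideals\<close>

text \<open>Used for the socle and for its closure. Statements about cosets are translated into
  congruences between representatives, where all computations take place.\<close>

locale two_sided_ideal =
  fixes J :: "'a::complex_banach_algebra set"
  assumes zero_mem: "0 \<in> J"
    and add_mem: "x \<in> J \<Longrightarrow> y \<in> J \<Longrightarrow> x + y \<in> J"
    and mult_left_mem: "x \<in> J \<Longrightarrow> a * x \<in> J"
    and mult_right_mem: "x \<in> J \<Longrightarrow> x * a \<in> J"
begin

lemma uminus_mem: "x \<in> J \<Longrightarrow> - x \<in> J"
  using mult_left_mem[of x "- 1"] by simp

lemma diff_mem: "x \<in> J \<Longrightarrow> y \<in> J \<Longrightarrow> x - y \<in> J"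
  using add_mem[OF _ uminus_mem, of x y] by simp

lemma scale_mem: "x \<in> J \<Longrightarrow> c *\<^sub>C x \<in> J"
  using mult_left_mem[of x "c *\<^sub>C 1"] by (simp add: scaleC_simps)

definition cong :: "'a \<Rightarrow> 'a \<Rightarrow> bool"  (infix \<open>\<sim>\<close> 50) where
  "x \<sim> y \<longleftrightarrow> x - y \<in> J"

lemma cong_refl [simp]: "x \<sim> x"
  by (simp add: cong_def zero_mem)

lemma cong_sym: "x \<sim> y \<Longrightarrow> y \<sim> x"
  unfolding cong_def using uminus_mem[of "x - y"] by simp

lemma cong_trans [trans]: "x \<sim> y \<Longrightarrow> y \<sim> z \<Longrightarrow> x \<sim> z"
  unfolding cong_def using add_mem[of "x - y" "y - z"] by simp

lemma cong_diff: "x \<sim> x' \<Longrightarrow> y \<sim> y' \<Longrightarrow> x - y \<sim> x' - y'"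
  unfolding cong_def using diff_mem[of "x - x'" "y - y'"] by (simp add: algebra_simps)

lemma cong_mult: "x \<sim> x' \<Longrightarrow> y \<sim> y' \<Longrightarrow> x * y \<sim> x' * y'"
  unfolding cong_def using add_mem[OF mult_right_mem[of "x - x'" y] mult_left_mem[of "y - y'" x']]
  by (simp add: algebra_simps)

lemma cong_mult_left: "y \<sim> y' \<Longrightarrow> x * y \<sim> x * y'"
  by (simp add: cong_mult)

lemma cong_mult_right: "x \<sim> x' \<Longrightarrow> x * y \<sim> x' * y"
  by (simp add: cong_mult)

lemma mem_cong: "x \<sim> y \<Longrightarrow> y \<in> J \<Longrightarrow> x \<in> J"
  unfolding cong_def using add_mem[of "x - y" y] by simp

lemma ideal_alg: "ideal J alg"
proof (rule idealI[OF ring_alg])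
  interpret ring "alg :: 'a ring" by (rule ring_alg)
  show "subgroup J (add_monoid alg)"
  proof
    fix x assume "x \<in> J"
    have "inv\<^bsub>add_monoid alg\<^esub> x = \<zero>\<^bsub>alg\<^esub> \<ominus>\<^bsub>alg\<^esub> x"
      by (simp add: a_minus_def a_inv_def del: alg_minus)
    thus "inv\<^bsub>add_monoid alg\<^esub> x \<in> J"
      using \<open>x \<in> J\<close> by (simp add: uminus_mem)
  qed (simp_all add: zero_mem add_mem)
qed (simp_all add: mult_left_mem mult_right_mem)

lemma quot_map_eq_iff: "quot_map J x = quot_map J y \<longleftrightarrow> x \<sim> y"
  using ring.quotient_eq_iff_same_a_r_cos[OF ring_alg ideal_alg, of x y] by (simp add: cong_def)

lemma quot_carrier: "carrier (alg Quot J) = range (quot_map J)"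
  by (auto simp: FactRing_def A_RCOSETS_defs a_r_coset_def)

lemma quot_mult: "quot_map J x \<otimes>\<^bsub>alg Quot J\<^esub> quot_map J y = quot_map J (x * y)"
  using ring_hom_mult[OF ideal.rcos_ring_hom[OF ideal_alg], of x y] by simp

lemma quot_one: "\<one>\<^bsub>alg Quot J\<^esub> = quot_map J 1"
  using ring_hom_one[OF ideal.rcos_ring_hom[OF ideal_alg]] by simp

lemma quot_minus: "quot_map J x \<ominus>\<^bsub>alg Quot J\<^esub> quot_map J y = quot_map J (x - y)"
proof -
  interpret ring_hom_ring alg "alg Quot J" "quot_map J"
    by (rule ideal.rcos_ring_hom_ring[OF ideal_alg])
  have "quot_map J (x \<ominus>\<^bsub>alg\<^esub> y) = quot_map J x \<ominus>\<^bsub>alg Quot J\<^esub> quot_map J y"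
    by (simp add: a_minus_def del: alg_minus alg_sel(3))
  thus ?thesis by simp
qed

lemma quot_pow: "quot_map J x [^]\<^bsub>alg Quot J\<^esub> (n::nat) = quot_map J (x ^ n)"
  by (induction n) (simp_all add: quot_one quot_mult power_commutes)

lemma quot_Units: "quot_map J x \<in> Units (alg Quot J) \<longleftrightarrow> (\<exists>y. x * y \<sim> 1 \<and> y * x \<sim> 1)"
  unfolding Units_def quot_carrier by (auto simp: quot_mult quot_one quot_map_eq_iff)

lemma quot_drazin_inverse:
  "is_drazin_inverse (alg Quot J) (quot_map J a) (quot_map J b) \<longleftrightarrow>
    b * a * b \<sim> b \<and> a * b \<sim> b * a \<and> (\<exists>k. a ^ k * b * a \<sim> a ^ k)"
  unfolding is_drazin_inverse_def quot_carrier by (simp add: rangeI quot_mult quot_pow quot_map_eq_iff)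

lemma quot_drazin_invertible:
  "drazin_invertible (alg Quot J) (quot_map J a) \<longleftrightarrow>
    (\<exists>b. b * a * b \<sim> b \<and> a * b \<sim> b * a \<and> (\<exists>k. a ^ k * b * a \<sim> a ^ k))"
proof -
  have "drazin_invertible (alg Quot J) (quot_map J a) \<longleftrightarrow>
      (\<exists>b. is_drazin_inverse (alg Quot J) (quot_map J a) (quot_map J b))"
    unfolding drazin_invertible_def using quot_carrier by (metis imageE is_drazin_inverse_def)
  thus ?thesis
    by (simp add: quot_drazin_inverse)
qed

lemma quot_quasinilpotent:
  "quasinilpotent (alg Quot J) (\<lambda>z. quot_map J (z *\<^sub>C 1)) (quot_map J a) \<longleftrightarrow>
    (\<forall>z. z \<noteq> 0 \<longrightarrow> (\<exists>y. (z *\<^sub>C 1 - a) * y \<sim> 1 \<and> y * (z *\<^sub>C 1 - a) \<sim> 1))"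
  unfolding quasinilpotent_def ring_spectrum_def by (auto simp: quot_minus quot_Units)

lemma closure_two_sided_ideal: "two_sided_ideal (closure J)"
proof
  show "0 \<in> closure J"
    using zero_mem closure_subset by blast
  show "x + y \<in> closure J" if xy: "x \<in> closure J" "y \<in> closure J" for x y
  proof -
    obtain f g where "\<forall>n. f n \<in> J" "f \<longlonglongrightarrow> x" "\<forall>n. g n \<in> J" "g \<longlonglongrightarrow> y"
      using xy unfolding closure_sequential by blast
    thus ?thesis
      unfolding closure_sequential
      by (intro exI[of _ "\<lambda>n. f n + g n"]) (simp add: add_mem tendsto_add)
  qed
  show "a * x \<in> closure J" if x: "x \<in> closure J" for x a
  proof -
    obtain f where "\<forall>n. f n \<in> J" "f \<longlonglongrightarrow> x"
      using x unfolding closure_sequential by blast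
    thus ?thesis
      unfolding closure_sequential
      by (intro exI[of _ "\<lambda>n. a * f n"]) (simp add: mult_left_mem tendsto_mult_left)
  qed
  show "x * a \<in> closure J" if x: "x \<in> closure J" for x a
  proof -
    obtain f where "\<forall>n. f n \<in> J" "f \<longlonglongrightarrow> x"
      using x unfolding closure_sequential by blast
    thus ?thesis
      unfolding closure_sequential
      by (intro exI[of _ "\<lambda>n. f n * a"]) (simp add: mult_right_mem tendsto_mult_right)
  qed
qed

section \<open>The distance to an ideal as quotient seminorm\<close>

lemma infdist_approx:
  assumes "e > 0"
  obtains j where "j \<in> J" "norm (x - j) < infdist x J + e"
proof -
  have "J \<noteq> {}"
    using zero_mem by blast
  moreover have "Inf (dist x ` J) < infdist x J + e"
    using assms \<open>J \<noteq> {}\<close> by (simp add: infdist_def)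
  ultimately obtain j where "j \<in> J" "dist x j < infdist x J + e"
    using cInf_lessD[of "dist x ` J"] by blast
  thus ?thesis
    using that by (simp add: dist_norm)
qed

lemma infdist_le_norm: "j \<in> J \<Longrightarrow> infdist x J \<le> norm (x - j)"
  using infdist_le[of j J x] by (simp add: dist_norm)

text \<open>Approximate \<open>x\<close> and \<open>y\<close> by elements \<open>j\<close> and
  \<open>j'\<close> of the ideal; \<open>(x - j) * (y - j')\<close> differs from
  \<open>x * y\<close> by an element of the ideal. Homogeneity follows from one inequality, applied
  to \<open>c\<close> and to its inverse.\<close>

lemma infdist_seminorm: "algebra_seminorm (\<lambda>x. infdist x J)"
proof
  fix x y :: 'a
  have "infdist (x + y) J \<le> infdist x J + infdist y J + e" if "e > 0" for e
  proof -
    obtain j j' where j: "j \<in> J" "norm (x - j) < infdist x J + e / 2"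
        "j' \<in> J" "norm (y - j') < infdist y J + e / 2"
      using infdist_approx[of "e / 2"] \<open>e > 0\<close> by (metis half_gt_zero)
    have "infdist (x + y) J \<le> norm ((x - j) + (y - j'))"
      using infdist_le_norm[OF add_mem[OF j(1,3)], of "x + y"] by (simp add: algebra_simps)
    also have "\<dots> \<le> norm (x - j) + norm (y - j')"
      by (rule norm_triangle_ineq)
    finally show ?thesis
      using j by simp
  qed
  thus "infdist (x + y) J \<le> infdist x J + infdist y J"
    by (rule field_le_epsilon)
  have le: "infdist (x * y) J \<le> (infdist x J + e) * (infdist y J + e)" if e: "e > 0" for e
  proof -
    obtain j j' where j: "j \<in> J" "norm (x - j) < infdist x J + e"
        "j' \<in> J" "norm (y - j') < infdist y J + e"
      using infdist_approx[OF e] by metis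
    have "x * j' + j * y - j * j' \<in> J"
      using j by (intro diff_mem add_mem mult_left_mem mult_right_mem)
    hence "infdist (x * y) J \<le> norm ((x - j) * (y - j'))"
      using infdist_le_norm[of "x * j' + j * y - j * j'" "x * y"] by (simp add: algebra_simps)
    also have "\<dots> \<le> norm (x - j) * norm (y - j')"
      by (rule norm_mult_ineq)
    also have "\<dots> \<le> (infdist x J + e) * (infdist y J + e)"
      using j by (intro mult_mono) (auto intro: order_trans[OF norm_ge_zero] less_imp_le)
    finally show ?thesis .
  qed
  have "((\<lambda>e. (infdist x J + e) * (infdist y J + e)) \<longlongrightarrow> (infdist x J + 0) * (infdist y J + 0)) (at_right 0)"
    by (intro tendsto_intros)
  moreover have "\<forall>\<^sub>F e in at_right 0. infdist (x * y) J \<le> (infdist x J + e) * (infdist y J + e)"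
    using eventually_at_right_less[of "0::real"] by (rule eventually_mono) (rule le)
  ultimately have "infdist (x * y) J \<le> (infdist x J + 0) * (infdist y J + 0)"
    by (rule tendsto_lowerbound) simp
  thus "infdist (x * y) J \<le> infdist x J * infdist y J"
    by simp
next
  fix c :: complex and x :: 'a
  have le: "infdist (c *\<^sub>C x) J \<le> cmod c * infdist x J" for c x
  proof (rule field_le_epsilon)
    fix e :: real assume "e > 0"
    define d where "d = e / (cmod c + 1)"
    have "d > 0"
      using \<open>e > 0\<close> by (simp add: d_def add_nonneg_pos)
    then obtain j where j: "j \<in> J" "norm (x - j) < infdist x J + d"
      by (rule infdist_approx)
    have "infdist (c *\<^sub>C x) J \<le> norm (c *\<^sub>C (x - j))"
      using infdist_le_norm[OF scale_mem[OF j(1), of c], of "c *\<^sub>C x"]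
      by (simp add: cvec.scale_right_diff_distrib)
    also have "\<dots> \<le> cmod c * (infdist x J + d)"
      using j by (simp add: norm_scaleC mult_left_mono)
    also have "cmod c * d \<le> (cmod c + 1) * d"
      using \<open>d > 0\<close> by (intro mult_right_mono) auto
    hence "cmod c * (infdist x J + d) \<le> cmod c * infdist x J + (cmod c + 1) * d"
      by (simp add: distrib_left)
    also have "(cmod c + 1) * d = e"
      using add_nonneg_pos[of "cmod c" 1] by (simp add: d_def)
    finally show "infdist (c *\<^sub>C x) J \<le> cmod c * infdist x J + e" .
  qed
  show "infdist (c *\<^sub>C x) J = cmod c * infdist x J"
  proof (cases "c = 0")
    case True
    thus ?thesis
      using zero_mem by simp
  next
    case False
    have "infdist x J \<le> inverse (cmod c) * infdist (c *\<^sub>C x) J"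
      using le[of "inverse c" "c *\<^sub>C x"] False by (simp add: norm_inverse)
    hence "cmod c * infdist x J \<le> infdist (c *\<^sub>C x) J"
      using False by (simp add: field_simps)
    thus ?thesis
      using le[of c x] by simp
  qed
qed

text \<open>
  A Drazin inverse turns quasinilpotence of \<open>f\<close> modulo \<open>J\<close> into an everywhere defined
  resolvent of \<open>f\<close> in the corner of the idempotent \<open>f b\<close>.
\<close>

lemma quasinilpotent_drazin_idempotent:
  assumes J: "closed J"
    and b: "b * f * b \<sim> b" "f * b \<sim> b * f"
    and q: "\<And>z. z \<noteq> 0 \<Longrightarrow> \<exists>y. (z *\<^sub>C 1 - f) * y \<sim> 1 \<and> y * (z *\<^sub>C 1 - f) \<sim> 1"
  shows "f * b \<in> J"
proof -
  interpret N: algebra_seminorm "\<lambda>x. infdist x J"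
    by (rule infdist_seminorm)
  have N: "infdist x J = 0 \<longleftrightarrow> x \<in> J" for x
    using in_closed_iff_infdist_zero[OF J] zero_mem by blast
  define p where "p = f * b"
  obtain w where w: "\<And>z. z \<noteq> 0 \<Longrightarrow> (z *\<^sub>C 1 - f) * w z \<sim> 1" "\<And>z. z \<noteq> 0 \<Longrightarrow> w z * (z *\<^sub>C 1 - f) \<sim> 1"
    using q by metis
  have pp: "p * p \<sim> p"
    using cong_mult_left[OF b(1), of f] by (simp add: p_def mult.assoc)
  have pf: "p * f \<sim> f * p"
    using cong_mult_left[OF cong_sym[OF b(2)], of f] by (simp add: p_def mult.assoc)
  have bp: "b * p \<sim> b"
    using b(1) by (simp add: p_def mult.assoc)
  have pb: "p * b \<sim> b"
    using cong_trans[OF cong_mult_right[OF b(2), of b] b(1)] by (simp add: p_def)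
  \<comment> \<open>Away from 0 the resolvent modulo \<open>J\<close> is compressed to the corner of
    \<open>p\<close>. At 0, where quasinilpotence says nothing, \<open>- b\<close> is the inverse of
    \<open>- (f * p)\<close> in that corner.\<close>
  define y where "y z = (if z = 0 then - b else p * w z * p)" for z
  have pz: "p * (z *\<^sub>C 1 - f) \<sim> (z *\<^sub>C 1 - f) * p" for z
    using cong_diff[OF cong_refl pf, of "z *\<^sub>C p"] by (simp add: algebra_simps scaleC_simps)
  have yp: "y z * p \<sim> y z" and py: "p * y z \<sim> y z" for z
  proof -
    have "- b * p \<sim> - b" "p * - b \<sim> - b"
      using cong_diff[OF cong_refl bp, of 0] cong_diff[OF cong_refl pb, of 0] by simp_all
    moreover have "p * w z * p * p \<sim> p * w z * p" "p * (p * w z * p) \<sim> p * w z * p"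
      using cong_mult_left[OF pp, of "p * w z"] cong_mult_right[OF pp, of "w z * p"]
      by (simp_all add: mult.assoc)
    ultimately show "y z * p \<sim> y z" "p * y z \<sim> y z"
      by (simp_all add: y_def)
  qed
  have zp: "z *\<^sub>C p - f * p = (z *\<^sub>C 1 - f) * p" for z
    by (simp add: left_diff_distrib scaleC_simps)
  have left: "y z * (z *\<^sub>C p - f * p) \<sim> p" for z
  proof (cases "z = 0")
    case True
    have "b * f * p \<sim> p * p"
      by (intro cong_mult_right) (use cong_sym[OF b(2)] in \<open>simp add: p_def\<close>)
    also note pp
    finally show ?thesis
      using True by (simp add: y_def mult.assoc)
  next
    case False
    have "p * w z * p * ((z *\<^sub>C 1 - f) * p) = p * w z * (p * (z *\<^sub>C 1 - f)) * p"
      by (simp only: mult.assoc)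
    also have "\<dots> \<sim> p * w z * ((z *\<^sub>C 1 - f) * p) * p"
      by (intro cong_mult cong_refl pz)
    also have "\<dots> = p * (w z * (z *\<^sub>C 1 - f)) * (p * p)"
      by (simp only: mult.assoc)
    also have "\<dots> \<sim> p * 1 * p"
      by (intro cong_mult cong_refl pp w False)
    also have "p * 1 * p \<sim> p"
      using pp by simp
    finally show ?thesis
      unfolding zp using False by (simp add: y_def)
  qed
  have right: "(z *\<^sub>C p - f * p) * y z \<sim> p" for z
  proof (cases "z = 0")
    case True
    have "f * (p * b) \<sim> p"
      using cong_mult_left[OF pb, of f] by (simp add: p_def)
    thus ?thesis
      using True by (simp add: y_def mult.assoc)
  next
    case False
    have "(z *\<^sub>C 1 - f) * p * (p * w z * p) = (z *\<^sub>C 1 - f) * (p * p) * (w z * p)"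
      by (simp only: mult.assoc)
    also have "\<dots> \<sim> (z *\<^sub>C 1 - f) * p * (w z * p)"
      by (intro cong_mult cong_refl pp)
    also have "\<dots> \<sim> p * (z *\<^sub>C 1 - f) * (w z * p)"
      by (intro cong_mult_right cong_sym[OF pz])
    also have "\<dots> = p * ((z *\<^sub>C 1 - f) * w z) * p"
      by (simp only: mult.assoc)
    also have "\<dots> \<sim> p * 1 * p"
      by (intro cong_mult cong_refl w False)
    also have "p * 1 * p \<sim> p"
      using pp by simp
    finally show ?thesis
      unfolding zp using False by (simp add: y_def)
  qed
  have "infdist p J = 0"
    using left right py yp
    by (intro N.corner_spectrum_nonempty[of y p "f * p"]) (simp_all add: N cong_def)
  thus ?thesis
    by (simp add: N p_def)
qed

end

lemma neumann_right_inverse: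
  fixes x :: "'a::complex_banach_algebra"
  assumes "norm x < 1"
  obtains y where "(1 - x) * y = 1"
proof -
  \<comment> \<open>The comparison starts at exponent 1, since \<open>norm 1\<close> may exceed
    1.\<close>
  have pow: "norm (x ^ Suc n) \<le> norm x ^ Suc n" for n
  proof (induction n)
    case (Suc n)
    have "norm (x ^ Suc (Suc n)) \<le> norm x * norm (x ^ Suc n)"
      using norm_mult_ineq[of x "x ^ Suc n"] by simp
    also have "\<dots> \<le> norm x * norm x ^ Suc n"
      using Suc by (intro mult_left_mono) auto
    finally show ?case by simp
  qed simp
  have geometric: "summable (\<lambda>n. norm x ^ Suc n)"
    using assms summable_Suc_iff[of "\<lambda>n. norm x ^ n"] by (simp add: summable_geometric del: power_Suc)
  have "summable (\<lambda>n. x ^ Suc n)"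
    by (rule summable_comparison_test[OF _ geometric]) (use pow in blast)
  hence sum: "summable (\<lambda>n. x ^ n)"
    using summable_Suc_iff[of "\<lambda>n. x ^ n"] by simp
  have "x * (\<Sum>n. x ^ n) = (\<Sum>n. x ^ Suc n)"
    using suminf_mult[OF sum, of x] by simp
  also have "\<dots> = (\<Sum>n. x ^ n) - 1"
    using suminf_split_head[OF sum] by simp
  finally show ?thesis
    by (intro that[of "\<Sum>n. x ^ n"]) (simp add: left_diff_distrib)
qed


section \<open>The equivalences\<close>

context
  assumes semisimple: "jacobson_radical = ({0} :: 'a::complex_banach_algebra set)"
begin

interpretation soc: two_sided_ideal "soc :: 'a set"
  unfolding soc_eq_soc_span[OF semisimple]
  by (rule two_sided_ideal.intro)
    (fact soc_span.zero soc_span_add soc_span_mult_left soc_span_mult_right)+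

interpretation closure_soc: two_sided_ideal "closure soc :: 'a set"
  by (rule soc.closure_two_sided_ideal)

lemma riesz_element_iff:
  fixes f :: 'a
  shows "riesz_element f \<longleftrightarrow>
    (\<forall>z. z \<noteq> 0 \<longrightarrow> (\<exists>y. closure_soc.cong ((z *\<^sub>C 1 - f) * y) 1 \<and> closure_soc.cong (y * (z *\<^sub>C 1 - f)) 1))"
  unfolding riesz_element_def by (rule closure_soc.quot_quasinilpotent)

text \<open>The geometric series for the inverse of \<open>z - f\<close>, cut off after
  \<open>n\<close> terms, is an inverse up to the error \<open>f^n / z^n\<close>, which lies in the
  socle.\<close>

lemma soc_power_imp_riesz:
  fixes f :: 'a
  assumes f: "f ^ n \<in> soc"
  shows "riesz_element f"
  unfolding riesz_element_iff
proof (intro allI impI)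
  fix z :: complex assume z: "z \<noteq> 0"
  define y where "y = (\<Sum>k<n. (1 / z ^ Suc k) *\<^sub>C f ^ k)"
  define x where "x = z *\<^sub>C 1 - f"
  have step: "x * ((1 / z ^ Suc k) *\<^sub>C f ^ k) = (1 / z ^ k) *\<^sub>C f ^ k - (1 / z ^ Suc k) *\<^sub>C f ^ Suc k" for k
    using z by (simp add: x_def left_diff_distrib scaleC_simps cvec.scale_right_diff_distrib)
  have "(\<Sum>k<m. x * ((1 / z ^ Suc k) *\<^sub>C f ^ k)) = 1 - (1 / z ^ m) *\<^sub>C f ^ m" for m
    by (induction m) (simp_all add: step del: power_Suc)
  hence xy: "x * y = 1 - (1 / z ^ n) *\<^sub>C f ^ n"
    unfolding y_def by (simp only: sum_distrib_left)
  have "f ^ k * x = x * f ^ k" for k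
    by (simp add: x_def left_diff_distrib right_diff_distrib scaleC_simps power_commutes)
  hence yx: "y * x = x * y"
    unfolding y_def by (simp add: sum_distrib_left sum_distrib_right scaleC_simps)
  have "(1 / z ^ n) *\<^sub>C f ^ n \<in> closure soc"
    using f closure_subset by (intro closure_soc.scale_mem) blast
  hence "closure_soc.cong (x * y) 1"
    unfolding xy closure_soc.cong_def using closure_soc.uminus_mem by simp
  thus "\<exists>y. closure_soc.cong ((z *\<^sub>C 1 - f) * y) 1 \<and> closure_soc.cong (y * (z *\<^sub>C 1 - f)) 1"
    using yx unfolding x_def by metis
qed

lemma soc_power_imp_drazin:
  fixes f :: 'a
  assumes f: "f ^ n \<in> soc" "n \<ge> 1"
  shows "drazin_invertible alg f"
proof -
  obtain b k where "b * f * b = b" "f * b = b * f" "f ^ k * b * f = f ^ k"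
    using soc_power_drazin[OF semisimple, of f n] f by (auto simp: soc_eq_soc_span[OF semisimple])
  thus ?thesis
    unfolding drazin_invertible_def is_drazin_inverse_def by (intro exI[of _ b]) auto
qed

lemma drazin_imp_b_fredholm:
  fixes f :: 'a
  assumes "drazin_invertible alg f"
  shows "b_fredholm f"
proof -
  obtain b k where "b * f * b = b" "f * b = b * f" "f ^ k * b * f = f ^ k"
    using assms by (auto simp: drazin_invertible_def is_drazin_inverse_def)
  thus ?thesis
    unfolding b_fredholm_def soc.quot_drazin_invertible
    by (intro exI[of _ b] conjI exI[of _ k]) simp_all
qed

lemma riesz_b_fredholm_imp_soc_power:
  fixes f :: 'a
  assumes f: "riesz_element f" "b_fredholm f"
  obtains n where "n \<ge> 1" "f ^ n \<in> soc"
proof -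
  obtain b k where b: "soc.cong (b * f * b) b" "soc.cong (f * b) (b * f)"
      "soc.cong (f ^ k * b * f) (f ^ k)"
    using f(2) unfolding b_fredholm_def soc.quot_drazin_invertible by blast
  define p where "p = f * b"
  have cl: "closure_soc.cong x y" if "soc.cong x y" for x y
    using that closure_subset unfolding soc.cong_def closure_soc.cong_def by blast
  have "p \<in> closure soc"
    unfolding p_def using f(1)
    by (intro closure_soc.quasinilpotent_drazin_idempotent cl b) (simp_all add: riesz_element_iff)
  then obtain s where s: "s \<in> soc" "norm (p - s) < 1"
    using closure_approachable[of p soc] by (metis dist_norm norm_minus_commute zero_less_one)
  obtain y where y: "(1 - (p - s)) * y = 1"
    using neumann_right_inverse[OF s(2)] .
  have "soc.cong (p * p) p"
    using soc.cong_mult_left[OF b(1), of f] by (simp add: p_def mult.assoc)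
  \<comment> \<open>This element is \<open>p * (1 - (p - s))\<close>, with \<open>s\<close> from the
    socle so close to \<open>p\<close> that the second factor has the right inverse
    \<open>y\<close>; multiplying by \<open>y\<close> recovers \<open>p\<close>.\<close>
  hence "p * s - (p * p - p) \<in> soc"
    unfolding soc.cong_def by (rule soc.diff_mem[OF soc.mult_left_mem[OF s(1)]])
  hence "(p * s - (p * p - p)) * y \<in> soc"
    by (rule soc.mult_right_mem)
  moreover have "(p * s - (p * p - p)) * y = p * ((1 - (p - s)) * y)"
    by (simp add: algebra_simps)
  ultimately have "p \<in> soc"
    by (simp add: y)
  have "soc.cong (f ^ k) (f ^ k * (b * f))"
    using soc.cong_sym[OF b(3)] by (simp add: mult.assoc)
  also have "soc.cong \<dots> (f ^ k * p)"
    unfolding p_def by (intro soc.cong_mult_left soc.cong_sym[OF b(2)])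
  finally have "f ^ k \<in> soc"
    by (rule soc.mem_cong) (intro soc.mult_left_mem \<open>p \<in> soc\<close>)
  \<comment> \<open>The exponent \<open>k\<close> may be 0, while a positive one is claimed.\<close>
  hence "f ^ Suc k \<in> soc"
    using soc.mult_left_mem[of "f ^ k" f] by simp
  thus ?thesis
    using that[of "Suc k"] by simp
qed

text \<open>Modulo the socle \<open>f\<close> is nilpotent, so its Drazin inverse is \<open>0\<close> and every \<open>a\<^sub>0\<close> lies in the socle.\<close>

lemma soc_power_imp_b_index:
  fixes f :: 'a
  assumes f: "f ^ n \<in> soc" "b_fredholm f"
  shows "b_index f = 0"
proof -
  define P where "P a \<longleftrightarrow> is_drazin_inverse (alg Quot soc) (quot_map soc f) (quot_map soc a)" for a :: 'a
  have "\<exists>a. P a"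
    using f(2) unfolding b_fredholm_def soc.quot_drazin_invertible P_def soc.quot_drazin_inverse .
  hence "P (SOME a. P a)"
    by (rule someI_ex)
  moreover have "alg_trace (f * a - a * f) = 0" if "P a" for a
  proof -
    have a: "soc.cong (a * f * a) a" "soc.cong (f * a) (a * f)"
      using that by (auto simp: P_def soc.quot_drazin_inverse)
    have aaf: "soc.cong a (a * (a * f))"
    proof -
      have "soc.cong a (a * (f * a))"
        using soc.cong_sym[OF a(1)] by (simp add: mult.assoc)
      also have "soc.cong \<dots> (a * (a * f))"
        by (intro soc.cong_mult_left a)
      finally show ?thesis .
    qed
    \<comment> \<open>Each use of \<open>aaf\<close> brings in one more factor \<open>f\<close> on
      the right; \<open>j = n\<close> makes \<open>f ^ n\<close> appear.\<close>
    have "soc.cong a (a ^ Suc j * f ^ j)" for j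
    proof (induction j)
      case (Suc j)
      also have "soc.cong (a ^ Suc j * f ^ j) (a ^ j * (a * (a * f)) * f ^ j)"
        using soc.cong_mult[OF soc.cong_mult_left[OF aaf, of "a ^ j"] soc.cong_refl[of "f ^ j"]]
        by (simp add: power_commutes)
      also have "a ^ j * (a * (a * f)) * f ^ j = a ^ Suc (Suc j) * f ^ Suc j"
        by (simp add: power_Suc2[of a] mult.assoc del: power_Suc) (simp add: mult.assoc)
      finally show ?case .
    qed simp
    from this[of n] have "a \<in> soc"
      by (rule soc.mem_cong) (intro soc.mult_left_mem f)
    thus ?thesis
      using alg_trace_commutator[OF semisimple] by (simp add: soc_eq_soc_span[OF semisimple])
  qed
  ultimately show ?thesis
    by (simp add: b_index_def Let_def P_def)
qed

end

theorem theorem6p2: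
  fixes f :: "'a::complex_banach_algebra"
  assumes semisimple: "jacobson_radical = ({0} :: 'a set)"
    and soc_nonzero: "soc \<noteq> ({0} :: 'a set)"
  shows "((\<exists>n\<ge>1. f ^ n \<in> soc) \<longleftrightarrow> riesz_element f \<and> drazin_invertible alg f) \<and>
    (riesz_element f \<and> drazin_invertible alg f \<longleftrightarrow> riesz_element f \<and> b_weyl f) \<and>
    (riesz_element f \<and> b_weyl f \<longleftrightarrow> riesz_element f \<and> b_fredholm f)"
proof -
  \<comment> \<open>Statement (i) yields all the others at once. Each of (ii) and (iii) gives (iv),
    so the cycle is closed by passing from (iv) back to (i).\<close>
  have "riesz_element f \<and> drazin_invertible alg f \<and> b_weyl f" if "n \<ge> 1" "f ^ n \<in> soc" for n
    using that soc_power_imp_riesz[OF semisimple] soc_power_imp_drazin[OF semisimple]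
      soc_power_imp_b_index[OF semisimple] drazin_imp_b_fredholm[OF semisimple]
    unfolding b_weyl_def by blast
  moreover have "drazin_invertible alg f \<Longrightarrow> b_fredholm f"
    by (rule drazin_imp_b_fredholm[OF semisimple])
  moreover have "\<exists>n\<ge>1. f ^ n \<in> soc" if "riesz_element f" "b_fredholm f"
    using riesz_b_fredholm_imp_soc_power[OF semisimple that] by blast
  moreover have "b_weyl f \<Longrightarrow> b_fredholm f"
    by (simp add: b_weyl_def)
  ultimately show ?thesis
    by blast
qed

end
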